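(* Let $\sigma=(\sigma_t)_{t\in\mathbb{R}}$ be a non-trivial smooth flow on a compact smooth manifold $M$. For $s\in\mathbb{R}_{>0}$ let $\beta_s:C^\infty(M)\to C^\infty(M)$, $\beta_s f=\frac1s\int_0^s f\circ\sigma_t\,dt$. Then: (1) If there is a point $p\in M$ whose orbit $\sigma_{\mathbb{R}}(p)$ is non-periodic and locally closed, then $\beta_s$ is not surjective for (Lebesgue-)almost all $s$. (2) If there exists $p\in M$ such that $T:=\overline{\sigma_{\mathbb{R}}(p)}$ is a torus (of positive dimension) on which the flow is linear, then $\beta_s$ is not surjective for a dense set of $s\in\mathbb{R}_{>0}$.
   Context: A smooth flow is a smooth action of $\mathbb{R}$ on $M$; it is non-trivial if some $\sigma_t\ne\mathrm{id}$. $C^\infty(M)$ denotes the real-valued smooth functions. The orbit of $p$ is $\sigma_{\mathbb{R}}(p)=\{\sigma_t(p):t\in\mathbb{R}\}$; it is non-periodic if $t\mapsto\sigma_t(p)$ is not periodic (in particular $p$ is not fixed), and locally closed if it is open in its closure. In (2), "$T$ is a torus on which the flow is linear" means that $T$ is an embedded submanifold of $M$ with a diffeomorphism $T\cong\mathbb{T}^d=(\mathbb{S}^1)^d$, $d\ge1$, under which the restricted flow has the form $(z_1,\dots,z_d)\mapsto(e^{it\theta_1}z_1,\dots,e^{it\theta_d}z_d)$ for some $(\theta_1,\dots,\theta_d)\in\mathbb{R}^d$. *)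

theory Defs
  imports "HOL-Analysis.Analysis"
begin

section \<open>Smooth maps between open subsets of normed spaces\<close>

primrec Ck_on :: "nat \<Rightarrow> 'a::real_normed_vector set \<Rightarrow> ('a \<Rightarrow> 'b::real_normed_vector) \<Rightarrow> bool" where
  "Ck_on 0 S f \<longleftrightarrow> continuous_on S f"
| "Ck_on (Suc k) S f \<longleftrightarrow>
     (\<forall>x\<in>S. f differentiable (at x)) \<and>
     (\<forall>v. Ck_on k S (\<lambda>x. frechet_derivative f (at x) v))"

text \<open>Only meaningful for open \<open>S\<close>, since the derivatives are taken at, not within \<open>S\<close>.\<close>

definition smooth_on :: "'a::real_normed_vector set \<Rightarrow> ('a \<Rightarrow> 'b::real_normed_vector) \<Rightarrow> bool" where
  "smooth_on S f \<longleftrightarrow> (\<forall>k. Ck_on k S f)"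


section \<open>Smooth manifolds\<close>

text \<open>
  A chart is a pair of its domain and the coordinate map; the values of the coordinate map outside
  the domain are irrelevant. The atlas of a manifold need not be maximal.
\<close>

type_synonym ('a, 'e) chart = "'a set \<times> ('a \<Rightarrow> 'e)"

record ('a, 'e) manifold =
  mtop :: "'a topology"
  atlas :: "('a, 'e) chart set"

abbreviation points :: "('a, 'e) manifold \<Rightarrow> 'a set" where
  "points M \<equiv> topspace (mtop M)"

definition is_chart :: "'a topology \<Rightarrow> ('a, 'e::euclidean_space) chart \<Rightarrow> bool" where
  "is_chart X c \<longleftrightarrow> (case c of (U, \<phi>) \<Rightarrow>
     openin X U \<and> open (\<phi> ` U) \<and>
     homeomorphic_map (subtopology X U) (top_of_set (\<phi> ` U)) \<phi>)"

definition smooth_compatible ::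
    "('a, 'e::euclidean_space) chart \<Rightarrow> ('a, 'e) chart \<Rightarrow> bool" where
  "smooth_compatible c d \<longleftrightarrow> (case (c, d) of ((U, \<phi>), (V, \<psi>)) \<Rightarrow>
     smooth_on (\<phi> ` (U \<inter> V)) (\<psi> \<circ> inv_into U \<phi>) \<and>
     smooth_on (\<psi> ` (U \<inter> V)) (\<phi> \<circ> inv_into V \<psi>))"

definition smooth_manifold :: "('a, 'e::euclidean_space) manifold \<Rightarrow> bool" where
  "smooth_manifold M \<longleftrightarrow>
     Hausdorff_space (mtop M) \<and> second_countable (mtop M) \<and>
     (\<forall>c\<in>atlas M. is_chart (mtop M) c) \<and>
     (\<Union>(U, \<phi>)\<in>atlas M. U) = points M \<and>
     (\<forall>c\<in>atlas M. \<forall>d\<in>atlas M. smooth_compatible c d)"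

definition maximal_atlas :: "('a, 'e::euclidean_space) manifold \<Rightarrow> ('a, 'e) chart set" where
  "maximal_atlas M = {c. is_chart (mtop M) c \<and> (\<forall>d\<in>atlas M. smooth_compatible c d)}"

definition smooth_map ::
    "('a, 'e::euclidean_space) manifold \<Rightarrow> ('b, 'f::euclidean_space) manifold \<Rightarrow> ('a \<Rightarrow> 'b) \<Rightarrow> bool" where
  "smooth_map M N f \<longleftrightarrow>
     continuous_map (mtop M) (mtop N) f \<and>
     (\<forall>(U, \<phi>)\<in>atlas M. \<forall>(V, \<psi>)\<in>atlas N.
        smooth_on (\<phi> ` {p\<in>U. f p \<in> V}) (\<psi> \<circ> f \<circ> inv_into U \<phi>))"

definition diffeomorphism ::
    "('a, 'e::euclidean_space) manifold \<Rightarrow> ('b, 'f::euclidean_space) manifold \<Rightarrow> ('a \<Rightarrow> 'b) \<Rightarrow> bool" where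
  "diffeomorphism M N h \<longleftrightarrow>
     bij_betw h (points M) (points N) \<and>
     smooth_map M N h \<and> smooth_map N M (inv_into (points M) h)"

definition euclidean_manifold :: "('e::euclidean_space, 'e) manifold" where
  "euclidean_manifold = \<lparr>mtop = euclidean, atlas = {(UNIV, id)}\<rparr>"

definition prod_manifold ::
    "('a, 'e::euclidean_space) manifold \<Rightarrow> ('b, 'f::euclidean_space) manifold
      \<Rightarrow> ('a \<times> 'b, 'e \<times> 'f) manifold" where
  "prod_manifold M N =
     \<lparr>mtop = prod_topology (mtop M) (mtop N),
      atlas = {(U \<times> V, map_prod \<phi> \<psi>) | U \<phi> V \<psi>. (U, \<phi>) \<in> atlas M \<and> (V, \<psi>) \<in> atlas N}\<rparr>"

text \<open>
  Functions on \<open>M\<close> are represented extensionally (\<open>undefined\<close> off the points of \<open>M\<close>).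
\<close>

definition smooth_functions :: "('a, 'e::euclidean_space) manifold \<Rightarrow> ('a \<Rightarrow> real) set" where
  "smooth_functions M =
     {f \<in> extensional (points M). smooth_map M (euclidean_manifold :: (real, real) manifold) f}"


section \<open>Embedded submanifolds\<close>

text \<open>
  The slice charts of a subset \<open>T\<close>, modelled on \<open>'f\<close>: a chart \<open>(U, \<phi>)\<close> of the maximal atlas that maps
  \<open>U \<inter> T\<close> onto \<open>\<phi> ` U \<inter> S\<close> for a linear subspace \<open>S\<close>, followed by a linear isomorphism from \<open>S\<close>
  to \<open>'f\<close>. In particular the dimension of \<open>S\<close> is \<open>DIM('f)\<close>.
\<close>

definition submanifold ::
    "('a, 'e::euclidean_space) manifold \<Rightarrow> 'a set \<Rightarrow> ('a, 'f::euclidean_space) manifold" where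
  "submanifold M T =
     \<lparr>mtop = subtopology (mtop M) T,
      atlas = {(U \<inter> T, g \<circ> \<phi>) | U \<phi> S g.
                 (U, \<phi>) \<in> maximal_atlas M \<and> subspace S \<and> linear g \<and> bij_betw g S UNIV \<and>
                 \<phi> ` (U \<inter> T) = \<phi> ` U \<inter> S}\<rparr>"

definition embedded_submanifold ::
    "'f::euclidean_space itself \<Rightarrow> ('a, 'e::euclidean_space) manifold \<Rightarrow> 'a set \<Rightarrow> bool" where
  "embedded_submanifold _ M T \<longleftrightarrow>
     T \<subseteq> points M \<and> (\<Union>(U, \<phi>)\<in>atlas (submanifold M T :: ('a, 'f) manifold). U) = T"


section \<open>Tori and linear flows on them\<close>

definition torus_exp :: "real ^ 'd \<Rightarrow> complex ^ 'd" where
  "torus_exp x = (\<chi> i. exp (\<i> * complex_of_real (x $ i)))"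

definition torus_box :: "real ^ 'd \<Rightarrow> (real ^ 'd) set" where
  "torus_box a = {x. \<forall>i. a $ i < x $ i \<and> x $ i < a $ i + 2 * pi}"

definition torus :: "(complex ^ 'd::finite, real ^ 'd) manifold" where
  "torus =
     \<lparr>mtop = top_of_set {z. \<forall>i. z $ i \<in> sphere 0 1},
      atlas = {(torus_exp ` torus_box a, inv_into (torus_box a) torus_exp) | a. True}\<rparr>"

definition linear_torus_flow :: "real ^ 'd \<Rightarrow> real \<Rightarrow> complex ^ 'd \<Rightarrow> complex ^ 'd" where
  "linear_torus_flow \<theta> t z = (\<chi> i. exp (\<i> * complex_of_real (t * \<theta> $ i)) * z $ i)"

text \<open>
  \<open>T\<close> is a torus of dimension \<open>CARD('d)\<close> on which the flow \<open>\<sigma>\<close> is linear. As types are nonempty,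
  the dimension is positive.
\<close>

definition linear_flow_torus ::
    "'d::finite itself \<Rightarrow> ('a, 'e::euclidean_space) manifold \<Rightarrow> (real \<Rightarrow> 'a \<Rightarrow> 'a) \<Rightarrow> 'a set \<Rightarrow> bool" where
  "linear_flow_torus _ M \<sigma> T \<longleftrightarrow>
     embedded_submanifold TYPE(real ^ 'd) M T \<and>
     (\<exists>h \<theta>. diffeomorphism (submanifold M T :: ('a, real ^ 'd) manifold)
              (torus :: (complex ^ 'd, real ^ 'd) manifold) h \<and>
            (\<forall>t. \<forall>q\<in>T. \<sigma> t q \<in> T \<and> h (\<sigma> t q) = linear_torus_flow \<theta> t (h q)))"


section \<open>Smooth flows\<close>

definition smooth_flow :: "('a, 'e::euclidean_space) manifold \<Rightarrow> (real \<Rightarrow> 'a \<Rightarrow> 'a) \<Rightarrow> bool" where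
  "smooth_flow M \<sigma> \<longleftrightarrow>
     (\<forall>t. \<forall>p\<in>points M. \<sigma> t p \<in> points M) \<and>
     (\<forall>p\<in>points M. \<sigma> 0 p = p) \<and>
     (\<forall>s t. \<forall>p\<in>points M. \<sigma> (s + t) p = \<sigma> s (\<sigma> t p)) \<and>
     smooth_map (prod_manifold (euclidean_manifold :: (real, real) manifold) M) M (\<lambda>(t, p). \<sigma> t p)"

definition nontrivial_flow :: "('a, 'e) manifold \<Rightarrow> (real \<Rightarrow> 'a \<Rightarrow> 'a) \<Rightarrow> bool" where
  "nontrivial_flow M \<sigma> \<longleftrightarrow> (\<exists>t. \<exists>p\<in>points M. \<sigma> t p \<noteq> p)"

definition flow_orbit :: "(real \<Rightarrow> 'a \<Rightarrow> 'a) \<Rightarrow> 'a \<Rightarrow> 'a set" where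
  "flow_orbit \<sigma> p = range (\<lambda>t. \<sigma> t p)"

definition nonperiodic_orbit :: "(real \<Rightarrow> 'a \<Rightarrow> 'a) \<Rightarrow> 'a \<Rightarrow> bool" where
  "nonperiodic_orbit \<sigma> p \<longleftrightarrow> \<not> (\<exists>r>0. \<forall>t. \<sigma> (t + r) p = \<sigma> t p)"

definition locally_closed_in :: "'a topology \<Rightarrow> 'a set \<Rightarrow> bool" where
  "locally_closed_in X S \<longleftrightarrow> openin (subtopology X (X closure_of S)) S"

definition flow_average ::
    "('a, 'e) manifold \<Rightarrow> (real \<Rightarrow> 'a \<Rightarrow> 'a) \<Rightarrow> real \<Rightarrow> ('a \<Rightarrow> real) \<Rightarrow> 'a \<Rightarrow> real" where
  "flow_average M \<sigma> s f = (\<lambda>p\<in>points M. (1 / s) * integral {0..s} (\<lambda>t. f (\<sigma> t p)))"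

definition average_surjective ::
    "('a, 'e::euclidean_space) manifold \<Rightarrow> (real \<Rightarrow> 'a \<Rightarrow> 'a) \<Rightarrow> real \<Rightarrow> bool" where
  "average_surjective M \<sigma> s \<longleftrightarrow>
     (\<forall>g\<in>smooth_functions M. \<exists>f\<in>smooth_functions M. flow_average M \<sigma> s f = g)"

end

theory Submission
  imports Defs
begin

text \<open>
  Suppose that \<open>\<beta>\<^sub>s f = g\<close>, and let \<open>l > 0\<close> satisfy \<open>exp (\<i> l s) = 1\<close>. Then the function
  \<open>C q = \<integral>\<^sub>0\<^sup>s f (\<sigma> t q) (exp (- \<i> l t) - 1) dt\<close> is continuous on \<open>M\<close>, and
  \<open>J x = exp (- \<i> l x) C (\<sigma> x p)\<close> has the derivative \<open>\<i> l s exp (- \<i> l x) g (\<sigma> x p)\<close>. In both parts \<open>g\<close> is a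
  smooth bump function at \<open>p\<close>, with support so small that \<open>cos (l x) \<ge> 0\<close> whenever \<open>g (\<sigma> x p) \<noteq> 0\<close>;
  hence \<open>Im J\<close> is increasing, strictly so at \<open>0\<close>.

  (1) Take \<open>l = 2 \<pi> / s\<close>. The orbit is homeomorphic to the real line by Baire's theorem, so \<open>g\<close> can be
  chosen to vanish at \<open>\<sigma> x p\<close> unless \<open>\<bar>x\<bar> < s / 4\<close>. Then \<open>J\<close> is constant near \<open>+\<infinity>\<close> and near \<open>-\<infinity>\<close>, and one of
  the two constants is nonzero, say the first. If \<open>u\<^sub>n \<longlongrightarrow> \<infinity>\<close> is a sequence, chosen independently of \<open>s\<close>,
  along which \<open>\<sigma> u\<^sub>n p\<close> converges, then \<open>exp (\<i> l u\<^sub>n)\<close> converges. This happens only for a null set of \<open>l\<close>.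

  (2) Take \<open>l\<close> to be a multiple of a nonzero frequency \<open>\<bar>\<theta>\<^sub>i\<bar>\<close> of the torus; the corresponding \<open>s\<close> are dense.
  The flow on the torus is recurrent: \<open>\<sigma> u\<^sub>n p \<longlongrightarrow> p\<close> and \<open>exp (\<i> l u\<^sub>n) \<longlongrightarrow> 1\<close> for some \<open>u\<^sub>n \<longlongrightarrow> \<infinity>\<close>. Thus
  \<open>J u\<^sub>n \<longlongrightarrow> J 0\<close>, which contradicts the growth of \<open>Im J\<close>.
\<close>

section \<open>Calculus of smooth maps\<close>

text \<open>Openness of \<open>S\<close> makes the derivative at a point of \<open>S\<close> depend
  only on the values in \<open>S\<close>, so the agreement passes to all derivatives.\<close>

lemma Ck_on_cong:
  assumes "open S" and "\<And>x. x \<in> S \<Longrightarrow> f x = g x" and "Ck_on k S f"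
  shows "Ck_on k S g"
  using assms(2,3)
proof (induction k arbitrary: f g)
  case 0
  then show ?case by (auto intro: continuous_on_cong[THEN iffD1])
next
  case (Suc k)
  have der: "(g has_derivative frechet_derivative f (at x)) (at x)" if "x \<in> S" for x
  proof (rule has_derivative_transform_within_open[OF _ \<open>open S\<close> that])
    show "(f has_derivative frechet_derivative f (at x)) (at x)"
      using Suc.prems(2) that by (simp flip: frechet_derivative_works)
  qed (use Suc.prems(1) in auto)
  have eq: "frechet_derivative g (at x) = frechet_derivative f (at x)" if "x \<in> S" for x
    using frechet_derivative_at[OF der[OF that]] by simp
  have "Ck_on k S (\<lambda>x. frechet_derivative g (at x) v)" for v
    by (rule Suc.IH[of "\<lambda>x. frechet_derivative f (at x) v"]) (use Suc.prems(2) eq in auto)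
  then show ?case
    using der by (auto simp: differentiable_def)
qed

text \<open>Being differentiable at a point is a local matter. A function that is given by different
  formulas on different open sets, such as an extension by zero, can thus be treated
  piecewise.\<close>

lemma Ck_on_local:
  assumes "\<And>x. x \<in> S \<Longrightarrow> \<exists>T. open T \<and> x \<in> T \<and> Ck_on k T f"
  shows "Ck_on k S f"
  using assms
proof (induction k arbitrary: f)
  case 0
  have "isCont f x" if "x \<in> S" for x
    using 0[OF that] by (auto simp: continuous_on_eq_continuous_at)
  then show ?case by (auto intro: continuous_at_imp_continuous_on)
next
  case (Suc k)
  have "f differentiable (at x)" if "x \<in> S" for x
    using Suc.prems[OF that] by auto
  moreover have "Ck_on k S (\<lambda>x. frechet_derivative f (at x) v)" for v
    by (rule Suc.IH) (use Suc.prems in fastforce)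
  ultimately show ?case by simp
qed

lemma Ck_on_SucD_le: "Ck_on (Suc k) S f \<Longrightarrow> Ck_on k S f"
proof (induction k arbitrary: f)
  case 0
  then show ?case
    by (auto intro!: continuous_at_imp_continuous_on differentiable_imp_continuous_within)
next
  case (Suc k)
  then have "Ck_on k S (\<lambda>x. frechet_derivative f (at x) v)" for v
    by (metis Ck_on.simps(2))
  then show ?case using Suc.prems by simp
qed

text \<open>Derivatives are unique, so any explicit formula may stand in for
  \<open>frechet_derivative\<close>.\<close>

lemma Ck_on_SucI:
  assumes "open S" and "\<And>x. x \<in> S \<Longrightarrow> (f has_derivative f' x) (at x)"
    and "\<And>v. Ck_on k S (\<lambda>x. f' x v)"
  shows "Ck_on (Suc k) S f"
proof -
  have "Ck_on k S (\<lambda>x. frechet_derivative f (at x) v)" for v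
    by (rule Ck_on_cong[OF \<open>open S\<close> _ assms(3)[of v]])
      (use assms(2) frechet_derivative_at in metis)
  then show ?thesis using assms(2) by (auto simp: differentiable_def)
qed

lemma Ck_on_SucD:
  assumes "Ck_on (Suc k) S f"
  shows "x \<in> S \<Longrightarrow> (f has_derivative frechet_derivative f (at x)) (at x)"
    and "Ck_on k S (\<lambda>x. frechet_derivative f (at x) v)"
  using assms by (auto simp flip: frechet_derivative_works)

lemma Ck_on_const: "open S \<Longrightarrow> Ck_on k S (\<lambda>x. c)"
proof (induction k arbitrary: c)
  case (Suc k)
  then show ?case
    by (intro Ck_on_SucI[where f' = "\<lambda>_ _. 0"]) auto
qed simp

lemma Ck_on_add: 
  "open S \<Longrightarrow> Ck_on k S f \<Longrightarrow> Ck_on k S g \<Longrightarrow> Ck_on k S (\<lambda>x. f x + g x)"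
proof (induction k arbitrary: f g)
  case 0
  then show ?case by (auto intro: continuous_intros)
next
  case (Suc k)
  note f = Ck_on_SucD[OF Suc.prems(2)] and g = Ck_on_SucD[OF Suc.prems(3)]
  show ?case
    by (rule Ck_on_SucI[OF Suc.prems(1) has_derivative_add[OF f(1) g(1)]])
      (use Suc.IH[OF Suc.prems(1)] f(2) g(2) in auto)
qed

lemma Ck_on_sum:
  assumes "open S" and "\<And>i. i \<in> I \<Longrightarrow> Ck_on k S (f i)"
  shows "Ck_on k S (\<lambda>x. \<Sum>i\<in>I. f i x)"
  using assms(2)
proof (induction I rule: infinite_finite_induct)
  case (insert i I)
  then show ?case by (auto intro: Ck_on_add[OF \<open>open S\<close>])
qed (simp_all add: Ck_on_const[OF \<open>open S\<close>])

text \<open>The product rule gives two products of the same shape, to which the induction hypothesis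
  applies. Multiplication, \<open>scaleR\<close> and \<open>inner\<close> are all covered.\<close>

lemma (in bounded_bilinear) Ck_on:
  assumes "open S" and "Ck_on k S f" and "Ck_on k S g"
  shows "Ck_on k S (\<lambda>x. prod (f x) (g x))"
  using assms(2,3)
proof (induction k arbitrary: f g)
  case 0
  then show ?case by (auto intro: continuous_on)
next
  case (Suc k)
  note f = Ck_on_SucD[OF Suc.prems(1)] and g = Ck_on_SucD[OF Suc.prems(2)]
  note fg = Ck_on_SucD_le[OF Suc.prems(1)] Ck_on_SucD_le[OF Suc.prems(2)]
  show ?case
    by (rule Ck_on_SucI[OF \<open>open S\<close> FDERIV[OF f(1) g(1)]])
      (auto intro!: Ck_on_add[OF \<open>open S\<close>] Suc.IH f(2) g(2) fg)
qed

text \<open>\<open>Ck_on\<close> controls derivatives in fixed directions, whereas the chain rule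
  differentiates \<open>f\<close> in a direction that varies with \<open>x\<close>. Expanding this
  direction in the basis leaves fixed directions with scalar coefficients.\<close>

lemma Ck_on_compose:
  fixes f :: "'b::euclidean_space \<Rightarrow> 'c::real_normed_vector"
    and g :: "'a::real_normed_vector \<Rightarrow> 'b"
  assumes "open S" and "g ` S \<subseteq> T" and "Ck_on k T f" and "Ck_on k S g"
  shows "Ck_on k S (\<lambda>x. f (g x))"
  using assms(3,4)
proof (induction k arbitrary: f)
  case 0
  then show ?case using assms(2) by (auto intro: continuous_on_compose2)
next
  case (Suc k)
  note f = Ck_on_SucD[OF Suc.prems(1)] and g = Ck_on_SucD[OF Suc.prems(2)]
  let ?h = "\<lambda>x v. \<Sum>i\<in>Basis. (frechet_derivative g (at x) v \<bullet> i) *\<^sub>R frechet_derivative f (at (g x)) i"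
  have "((\<lambda>x. f (g x)) has_derivative ?h x) (at x)" if x: "x \<in> S" for x
  proof -
    have fx: "(f has_derivative frechet_derivative f (at (g x))) (at (g x))"
      using f(1) x assms(2) by auto
    have lin: "linear (frechet_derivative f (at (g x)))"
      by (rule has_derivative_linear[OF fx])
    have "(\<lambda>w. frechet_derivative f (at (g x)) w) = (\<lambda>w. \<Sum>i\<in>Basis. (w \<bullet> i) *\<^sub>R frechet_derivative f (at (g x)) i)"
    proof
      show "frechet_derivative f (at (g x)) w = (\<Sum>i\<in>Basis. (w \<bullet> i) *\<^sub>R frechet_derivative f (at (g x)) i)" for w
        by (subst euclidean_representation[of w, symmetric])
          (simp only: linear_sum[OF lin] linear_cmul[OF lin])
    qed
    then have "frechet_derivative f (at (g x)) \<circ> frechet_derivative g (at x) = ?h x"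
      by (metis (no_types, lifting) comp_apply ext)
    then show ?thesis
      using diff_chain_at[OF g(1)[OF x] fx] by (simp add: comp_def[of f])
  qed
  moreover have "Ck_on k S (\<lambda>x. ?h x v)" for v
    by (intro Ck_on_sum[OF \<open>open S\<close>] bounded_bilinear.Ck_on[OF bounded_bilinear_scaleR \<open>open S\<close>]
        bounded_bilinear.Ck_on[OF bounded_bilinear_inner \<open>open S\<close>] g(2) Ck_on_const[OF \<open>open S\<close>]
        Suc.IH f(2) Ck_on_SucD_le[OF Suc.prems(2)])
  ultimately show ?case by (rule Ck_on_SucI[OF \<open>open S\<close>])
qed

lemma Ck_on_id: "open S \<Longrightarrow> Ck_on k S (\<lambda>x. x)"
proof (cases k)
  case (Suc m)
  assume "open S"
  then show ?thesis unfolding Suc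
    by (intro Ck_on_SucI[where f' = "\<lambda>_ v. v"] Ck_on_const) auto
qed simp

section \<open>Smooth bump functions\<close>

text \<open>The case \<open>n = 0\<close> is the classical flat function; the powers in the
  denominator make the family closed under differentiation up to linear combinations.\<close>

definition flat_fun :: "nat \<Rightarrow> real \<Rightarrow> real" where
  "flat_fun n t = (if t > 0 then exp (- (1 / t)) / t ^ n else 0)"

lemma flat_fun_lim: "((\<lambda>t::real. exp (- (1 / t)) / t ^ n) \<longlongrightarrow> 0) (at_right 0)"
proof -
  have "((\<lambda>x::real. x ^ n / exp x) \<longlongrightarrow> 0) at_top"
    by (rule tendsto_power_div_exp_0)
  from filterlim_compose[OF this filterlim_inverse_at_top_right] show ?thesis
    by (simp add: field_simps exp_minus)
qed

lemma flat_fun_deriv: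
  "(flat_fun n has_real_derivative flat_fun (n + 2) t - real n * flat_fun (n + 1) t) (at t)"
proof -
  consider "t > 0" | "t < 0" | "t = 0" by linarith
  then show ?thesis
  proof cases
    case 1
    have ev: "\<forall>\<^sub>F x in nhds t. exp (- (1 / x)) / x ^ n = flat_fun n x"
      using eventually_nhds_in_open[of "{0<..}" t] 1
      by (auto elim!: eventually_mono simp: flat_fun_def)
    have "((\<lambda>t. exp (- (1 / t)) / t ^ n) has_real_derivative
        flat_fun (n + 2) t - real n * flat_fun (n + 1) t) (at t)"
    proof -
      have "((\<lambda>t. exp (- (1 / t)) / t ^ n) has_real_derivative
          (exp (- (1 / t)) * (1 / t\<^sup>2) * t ^ n - exp (- (1 / t)) * (real n * t ^ (n - Suc 0)))
            / (t ^ n * t ^ n)) (at t)"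
        using 1 by (auto intro!: derivative_eq_intros simp: power2_eq_square)
      moreover have "(exp (- (1 / t)) * (1 / t\<^sup>2) * t ^ n - exp (- (1 / t)) * (real n * t ^ (n - Suc 0)))
            / (t ^ n * t ^ n) = flat_fun (n + 2) t - real n * flat_fun (n + 1) t"
        using 1 by (cases n) (auto simp: flat_fun_def field_simps power2_eq_square)
      ultimately show ?thesis by simp
    qed
    then show ?thesis
      using DERIV_cong_ev[OF refl ev refl] by simp
  next
    case 2
    have ev: "\<forall>\<^sub>F x in nhds t. 0 = flat_fun n x"
      using eventually_nhds_in_open[of "{..<0}" t] 2
      by (auto elim!: eventually_mono simp: flat_fun_def)
    have "((\<lambda>t. 0) has_real_derivative
        flat_fun (n + 2) t - real n * flat_fun (n + 1) t) (at t)"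
      using 2 by (simp add: flat_fun_def)
    then show ?thesis
      using DERIV_cong_ev[OF refl ev refl] by simp
  next
    case 3
    \<comment> \<open>At \<open>0\<close> the difference quotient is
      \<open>flat_fun n h / h\<close>, which for \<open>h > 0\<close> is the expression of
      \<open>flat_fun_lim\<close> with exponent \<open>Suc n\<close>.\<close>
    have "((\<lambda>h. flat_fun n h / h) \<longlongrightarrow> 0) (at_left 0)"
      by (rule tendsto_eventually) (auto simp: flat_fun_def eventually_at_left_field intro!: exI[of _ "-1"])
    moreover have "((\<lambda>h. flat_fun n h / h) \<longlongrightarrow> 0) (at_right 0)"
      using flat_fun_lim[of "Suc n"]
      by (rule Lim_transform_eventually)
        (auto simp: flat_fun_def eventually_at_right_field mult_ac intro!: exI[of _ 1])
    ultimately show ?thesis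
      using 3 by (auto simp: DERIV_def filterlim_split_at flat_fun_def)
  qed
qed

lemma Ck_on_flat_fun: "Ck_on k UNIV (flat_fun n)"
proof (induction k arbitrary: n)
  case 0
  then show ?case
    using flat_fun_deriv by (auto intro!: continuous_at_imp_continuous_on DERIV_isCont)
next
  case (Suc k)
  have "Ck_on k UNIV (\<lambda>t. flat_fun (n + 2) t + (- real n) * flat_fun (n + 1) t)"
    by (intro Ck_on_add bounded_bilinear.Ck_on[OF bounded_bilinear_mult] Ck_on_const Suc.IH open_UNIV)
  then have "Ck_on k UNIV (\<lambda>t. (flat_fun (n + 2) t - real n * flat_fun (n + 1) t) * v)" for v
    by (intro bounded_bilinear.Ck_on[OF bounded_bilinear_mult] Ck_on_const open_UNIV) simp_all
  then show ?case
    by (intro Ck_on_SucI[OF open_UNIV flat_fun_deriv[unfolded has_field_derivative_def]]) simp_all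
qed

text \<open>The squared distance is written as an inner product, which is visibly smooth, also at
  the centre.\<close>

definition bump :: "'a::euclidean_space \<Rightarrow> real \<Rightarrow> 'a \<Rightarrow> real" where
  "bump a r x = flat_fun 0 (r\<^sup>2 - (x - a) \<bullet> (x - a))"

lemma bump_nonneg: "bump a r x \<ge> 0"
  by (simp add: bump_def flat_fun_def)

lemma bump_center_pos: "r > 0 \<Longrightarrow> bump a r a > 0"
  by (simp add: bump_def flat_fun_def)

lemma bump_eq_0: 
  assumes "r > 0" "x \<notin> cball a r" 
  shows "bump a r x = 0"
proof -
  have "r\<^sup>2 \<le> (norm (x - a))\<^sup>2"
    using assms by (intro power_mono) (auto simp: dist_norm norm_minus_commute)
  then show ?thesis by (simp add: bump_def flat_fun_def power2_norm_eq_inner)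
qed

lemma Ck_on_bump: "Ck_on k UNIV (bump a r)"
proof -
  have id: "Ck_on k UNIV (\<lambda>x::'a. x + (- a))"
    by (intro Ck_on_add Ck_on_id Ck_on_const open_UNIV)
  have "Ck_on k UNIV (\<lambda>x::'a. r\<^sup>2 + (-1) * ((x + (- a)) \<bullet> (x + (- a))))"
    by (intro Ck_on_add Ck_on_const open_UNIV bounded_bilinear.Ck_on[OF bounded_bilinear_mult]
        bounded_bilinear.Ck_on[OF bounded_bilinear_inner] id)
  from Ck_on_compose[OF open_UNIV _ Ck_on_flat_fun[of k 0] this] show ?thesis
    unfolding bump_def[abs_def] by simp
qed

section \<open>Charts, and bump functions on manifolds\<close>

lemma is_chart_open_image:
  assumes "is_chart X (U, \<phi>)" and "openin X A" and "A \<subseteq> U"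
  shows "open (\<phi> ` A)"
proof -
  have "open_map (subtopology X U) (top_of_set (\<phi> ` U)) \<phi>"
    using assms(1) by (simp add: is_chart_def homeomorphic_imp_open_map)
  moreover have "openin (subtopology X U) A"
    using assms by (metis inf.absorb_iff1 openin_subtopology)
  ultimately have "openin (top_of_set (\<phi> ` U)) (\<phi> ` A)"
    by (simp add: open_map_def)
  then show ?thesis
    using assms(1) by (auto simp: is_chart_def openin_open)
qed

lemma is_chart_inj_on: "is_chart X (U, \<phi>) \<Longrightarrow> inj_on \<phi> U"
  using openin_subset[of X U] by (auto simp: is_chart_def homeomorphic_map_def homeomorphic_eq_everything_map inf_absorb2)

lemma is_chart_continuous:
  "is_chart X (U, \<phi>) \<Longrightarrow> continuous_map (subtopology X U) euclidean \<phi>"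
  by (auto simp: is_chart_def intro: continuous_map_into_fulltopology homeomorphic_imp_continuous_map)

text \<open>In a Hausdorff manifold this makes the preimage of a closed coordinate ball closed, as
  extension by zero requires.\<close>

lemma is_chart_compactin_vimage:
  assumes chart: "is_chart X (U, \<phi>)" and "compact C" and "C \<subseteq> \<phi> ` U"
  shows "compactin X {q \<in> U. \<phi> q \<in> C}"
proof -
  have "openin X U" and "homeomorphic_map (subtopology X U) (top_of_set (\<phi> ` U)) \<phi>"
    using chart by (auto simp: is_chart_def)
  then obtain \<psi> where \<psi>: "homeomorphic_maps (subtopology X U) (top_of_set (\<phi> ` U)) \<phi> \<psi>"
    using homeomorphic_map_maps by blast
  then have cont: "continuous_map (top_of_set (\<phi> ` U)) (subtopology X U) \<psi>"
    and inv: "\<And>q. q \<in> U \<Longrightarrow> \<psi> (\<phi> q) = q"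
    using openin_subset[OF \<open>openin X U\<close>] by (auto simp: homeomorphic_maps_def)
  have "compactin (top_of_set (\<phi> ` U)) C"
    using assms by (simp add: compactin_subtopology)
  from image_compactin[OF this cont] have "compactin X (\<psi> ` C)"
    by (simp add: compactin_subtopology)
  moreover have "\<psi> ` C = {q \<in> U. \<phi> q \<in> C}"
  proof (intro equalityI subsetI)
    fix q
    assume "q \<in> \<psi> ` C"
    then show "q \<in> {q \<in> U. \<phi> q \<in> C}"
      using \<open>C \<subseteq> \<phi> ` U\<close> inv by auto
  next
    fix q
    assume "q \<in> {q \<in> U. \<phi> q \<in> C}"
    then show "q \<in> \<psi> ` C"
      using inv by (metis (mono_tags, lifting) image_eqI mem_Collect_eq)
  qed
  ultimately show ?thesis by simp
qed

text \<open>A Euclidean bump is pulled back along a chart and extended by zero. The open sets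
  \<open>U0\<close> and \<open>points M - K\<close>, with \<open>K\<close> a closed coordinate ball,
  cover \<open>M\<close>, and \<open>g\<close> has a smooth formula on each.\<close>

lemma smooth_bump_function:
  fixes M :: "('a, 'e::euclidean_space) manifold"
  assumes M: "smooth_manifold M" and W: "openin (mtop M) W" "p \<in> W"
  obtains g where "g \<in> smooth_functions M" and "\<And>q. q \<in> points M \<Longrightarrow> g q \<ge> 0"
    and "g p > 0" and "\<And>q. q \<in> points M \<Longrightarrow> q \<notin> W \<Longrightarrow> g q = 0"
proof -
  let ?X = "mtop M"
  have p: "p \<in> points M"
    using W openin_subset by blast
  then have "p \<in> (\<Union>(U, \<phi>)\<in>atlas M. U)"
    using M by (simp add: smooth_manifold_def)
  then obtain U0 \<phi>0 where c0: "(U0, \<phi>0) \<in> atlas M" "p \<in> U0"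
    by auto
  have chart: "is_chart ?X c" if "c \<in> atlas M" for c
    using M that by (simp add: smooth_manifold_def)
  note chart0 = chart[OF c0(1)]
  have U0: "openin ?X U0"
    using chart0 by (simp add: is_chart_def)
  have "open (\<phi>0 ` (U0 \<inter> W))"
    by (rule is_chart_open_image[OF chart0]) (use U0 W in auto)
  moreover have "\<phi>0 p \<in> \<phi>0 ` (U0 \<inter> W)"
    using c0 W by blast
  ultimately obtain r where r: "r > 0" "cball (\<phi>0 p) r \<subseteq> \<phi>0 ` (U0 \<inter> W)"
    using open_contains_cball by blast
  define K where "K = {q \<in> U0. \<phi>0 q \<in> cball (\<phi>0 p) r}"
  have "compactin ?X K"
    unfolding K_def by (rule is_chart_compactin_vimage[OF chart0]) (use r in auto)
  then have K: "closedin ?X K"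
    using M compactin_imp_closedin by (auto simp: smooth_manifold_def)
  have KW: "K \<subseteq> W"
    using r(2) is_chart_inj_on[OF chart0] by (fastforce simp: K_def inj_on_def)
  define g where "g = (\<lambda>q\<in>points M. if q \<in> U0 then bump (\<phi>0 p) r (\<phi>0 q) else 0)"
  have gU: "g q = bump (\<phi>0 p) r (\<phi>0 q)" if "q \<in> U0" for q
    using that openin_subset[OF U0] by (auto simp: g_def)
  have gK: "g q = 0" if "q \<in> points M - K" for q
    using that r(1) bump_eq_0[of r "\<phi>0 q" "\<phi>0 p"] by (auto simp: g_def K_def)
  have opK: "openin ?X (points M - K)"
    using K by blast
  have contb: "continuous_map euclidean euclidean (bump (\<phi>0 p) r)"
    using Ck_on_bump[of 0] by simp
  have "continuous_map ?X euclidean g"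
  proof (rule pasting_lemma[of "{U0, points M - K}" ?X "\<lambda>i. i" euclidean "\<lambda>_. g"])
    have "continuous_map (subtopology ?X U0) euclidean (bump (\<phi>0 p) r \<circ> \<phi>0)"
      using is_chart_continuous[OF chart0] contb by (rule continuous_map_compose)
    then have "continuous_map (subtopology ?X U0) euclidean g"
      by (rule continuous_map_eq) (simp add: gU)
    moreover have "continuous_map (subtopology ?X (points M - K)) euclidean g"
      by (rule continuous_map_eq[of _ _ "\<lambda>_. 0"]) (auto simp: gK)
    ultimately show "continuous_map (subtopology ?X i) euclidean g" if "i \<in> {U0, points M - K}" for i
      using that by auto
    show "\<exists>j. j \<in> {U0, points M - K} \<and> x \<in> j \<and> g x = g x" if "x \<in> points M" for x
      using that by (auto simp: K_def)
  qed (use U0 opK in auto)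
  moreover have "smooth_on (\<phi> ` U) (g \<circ> inv_into U \<phi>)" if c: "(U, \<phi>) \<in> atlas M" for U \<phi>
    unfolding smooth_on_def
  proof (intro allI Ck_on_local)
    fix k y
    assume "y \<in> \<phi> ` U"
    then obtain q where q: "q \<in> U" "y = \<phi> q"
      by blast
    note ch = chart[OF c]
    have U: "openin ?X U"
      using ch by (simp add: is_chart_def)
    have inv: "inv_into U \<phi> (\<phi> q) = q" if "q \<in> U" for q
      using is_chart_inj_on[OF ch] that by simp
    show "\<exists>T. open T \<and> y \<in> T \<and> Ck_on k T (g \<circ> inv_into U \<phi>)"
    proof (cases "q \<in> U0")
      case True
      \<comment> \<open>On the overlap, \<open>g\<close> in the coordinates \<open>\<phi>\<close> is
        the Euclidean bump composed with the transition map to \<open>\<phi>0\<close>.\<close>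
      let ?T = "\<phi> ` (U \<inter> U0)"
      have T: "open ?T"
        by (rule is_chart_open_image[OF ch]) (use U U0 in auto)
      have "smooth_compatible (U, \<phi>) (U0, \<phi>0)"
        using M c c0 by (auto simp: smooth_manifold_def)
      then have "Ck_on k ?T (\<phi>0 \<circ> inv_into U \<phi>)"
        by (simp add: smooth_compatible_def smooth_on_def)
      from Ck_on_compose[OF T subset_UNIV Ck_on_bump this]
      have "Ck_on k ?T (g \<circ> inv_into U \<phi>)"
        by (rule Ck_on_cong[OF T, rotated]) (auto simp: inv gU)
      then show ?thesis using T True q by blast
    next
      case False
      let ?T = "\<phi> ` (U \<inter> (points M - K))"
      have T: "open ?T"
        by (rule is_chart_open_image[OF ch]) (use U opK in auto)
      have "Ck_on k ?T (g \<circ> inv_into U \<phi>)"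
        by (rule Ck_on_cong[OF T _ Ck_on_const[OF T, of k 0]]) (auto simp: inv gK)
      moreover have "q \<notin> K" "q \<in> points M"
        using False q openin_subset[OF U] by (auto simp: K_def)
      ultimately show ?thesis using T q by blast
    qed
  qed
  ultimately have "g \<in> smooth_functions M"
    by (auto simp: smooth_functions_def smooth_map_def euclidean_manifold_def g_def id_comp)
  then show thesis
  proof
    show "g q \<ge> 0" if "q \<in> points M" for q
      using that by (simp add: g_def bump_nonneg)
    show "g p > 0"
      using gU c0 r(1) by (simp add: bump_center_pos)
    show "g q = 0" if "q \<in> points M" "q \<notin> W" for q
      using that gK KW by blast
  qed
qed

section \<open>Convergent phases\<close>

lemma diverging_real_seq_subset:
  fixes t :: "nat \<Rightarrow> real"
  assumes "filterlim (\<lambda>n. \<bar>t n\<bar>) at_top sequentially"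
  shows "\<exists>I. finite I \<and> card I = L \<and> (\<forall>i\<in>I. i \<ge> N) \<and> (\<forall>i\<in>I. \<forall>j\<in>I. i \<noteq> j \<longrightarrow> \<bar>t i - t j\<bar> \<ge> d)"
proof (induction L)
  case 0
  then show ?case by (intro exI[of _ "{}"]) auto
next
  case (Suc L)
  then obtain I where I: "finite I" "card I = L" "\<forall>i\<in>I. i \<ge> N"
    "\<forall>i\<in>I. \<forall>j\<in>I. i \<noteq> j \<longrightarrow> \<bar>t i - t j\<bar> \<ge> d" by blast
  \<comment> \<open>A term of modulus at least \<open>B\<close> has distance at least
    \<open>d\<close> from all terms chosen so far; the summand \<open>1\<close> ensures that its
    index is new.\<close>
  define B where "B = (\<Sum>i\<in>I. \<bar>t i\<bar>) + \<bar>d\<bar> + 1"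
  have "\<forall>\<^sub>F n in sequentially. B \<le> \<bar>t n\<bar> \<and> n \<ge> N"
    using assms by (intro eventually_conj) (auto simp: filterlim_at_top eventually_sequentially)
  then obtain n where n: "B \<le> \<bar>t n\<bar>" "n \<ge> N"
    using eventually_happens'[OF sequentially_bot] by blast
  have le: "\<bar>t i\<bar> + \<bar>d\<bar> + 1 \<le> \<bar>t n\<bar>" if "i \<in> I" for i
    using member_le_sum[of i I "\<lambda>i. \<bar>t i\<bar>"] I(1) that n(1) by (simp add: B_def)
  then have "n \<notin> I" by fastforce
  moreover have "\<bar>t i - t n\<bar> \<ge> d" if "i \<in> I" for i
    using le[OF that] by linarith
  ultimately show ?case
    using I n by (intro exI[of _ "insert n I"]) (auto simp: abs_minus_commute)
qed

text \<open>The bound does not depend on the interval, so well separated \<open>t i\<close> make all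
  mixed terms of the double sum below small.\<close>

lemma has_integral_cos_mult:
  fixes a b w :: real
  assumes "w \<noteq> 0" and "a \<le> b"
  shows "((\<lambda>x. cos (x * w)) has_integral (sin (b * w) / w - sin (a * w) / w)) {a..b}"
    and "sin (b * w) / w - sin (a * w) / w \<le> 2 / \<bar>w\<bar>"
proof -
  show "((\<lambda>x. cos (x * w)) has_integral (sin (b * w) / w - sin (a * w) / w)) {a..b}"
    using assms
    by (intro fundamental_theorem_of_calculus)
      (auto intro!: derivative_eq_intros simp flip: has_real_derivative_iff_has_vector_derivative)
  have "sin (b * w) / w - sin (a * w) / w \<le> \<bar>sin (b * w) - sin (a * w)\<bar> / \<bar>w\<bar>"
    by (metis abs_divide abs_ge_self diff_divide_distrib)
  also have "\<dots> \<le> 2 / \<bar>w\<bar>"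
    using abs_sin_le_one[of "b * w"] abs_sin_le_one[of "a * w"]
    by (intro divide_right_mono) linarith+
  finally show "sin (b * w) / w - sin (a * w) / w \<le> 2 / \<bar>w\<bar>" .
qed

text \<open>The double sum is the squared modulus of the sum of the
  \<open>cis (x * t i)\<close>.\<close>

lemma sum_cos_diff_nonneg:
  fixes t :: "nat \<Rightarrow> real"
  shows "(\<Sum>i\<in>I. \<Sum>j\<in>I. cos (x * (t i - t j))) \<ge> 0"
proof -
  have "(\<Sum>i\<in>I. \<Sum>j\<in>I. cos (x * (t i - t j))) = (\<Sum>i\<in>I. cos (x * t i))\<^sup>2 + (\<Sum>i\<in>I. sin (x * t i))\<^sup>2"
    by (simp add: power2_eq_square sum_product right_diff_distrib cos_diff sum.distrib)
  then show ?thesis by simp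
qed

text \<open>On this set the double sum of \<open>cos (x * (t i - t j))\<close> over \<open>L\<close> indices is at least \<open>L\<^sup>2 / 2\<close>,
  whereas its integral is \<open>O(L)\<close> if the \<open>t i\<close> are \<open>L\<close>-separated.\<close>

lemma negligible_almost_constant_phase:
  fixes t :: "nat \<Rightarrow> real"
  assumes lim: "filterlim (\<lambda>n. \<bar>t n\<bar>) at_top sequentially" and "a \<le> b"
  shows "negligible {x \<in> {a..b}. \<forall>i\<ge>N. \<forall>j\<ge>N. cos (x * (t i - t j)) \<ge> 1 / 2}" (is "negligible ?K")
proof -
  \<comment> \<open>As an intersection of closed sets, \<open>?K\<close> is compact and therefore of
    finite measure.\<close>
  have "?K = {a..b} \<inter> (\<Inter>i\<in>{N..}. \<Inter>j\<in>{N..}. {x. cos (x * (t i - t j)) \<ge> 1 / 2})"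
    by auto
  also have "closed \<dots>"
    by (intro closed_Int closed_INT ballI closed_Collect_le continuous_intros) auto
  finally have "compact ?K"
    by (auto simp: compact_eq_bounded_closed intro: bounded_subset[of "{a..b}"])
  then have K: "?K \<in> lmeasurable"
    by (rule lmeasurable_compact)
  have le: "measure lebesgue ?K \<le> 2 * (b - a + 2) / real L" if "L > 0" for L :: nat
  proof -
    obtain I where I: "finite I" "card I = L" "\<And>i. i \<in> I \<Longrightarrow> i \<ge> N"
      "\<And>i j. i \<in> I \<Longrightarrow> j \<in> I \<Longrightarrow> i \<noteq> j \<Longrightarrow> \<bar>t i - t j\<bar> \<ge> real L"
      using diverging_real_seq_subset[OF lim, of L N "real L"] by blast
    define c where "c i j = (if i = j then b - a else
      sin (b * (t i - t j)) / (t i - t j) - sin (a * (t i - t j)) / (t i - t j))" for i j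
    have ne: "t i - t j \<noteq> 0" if "i \<in> I" "j \<in> I" "i \<noteq> j" for i j
      using I(4)[OF that] \<open>L > 0\<close> by auto
    have int: "((\<lambda>x. cos (x * (t i - t j))) has_integral c i j) {a..b}" if "i \<in> I" "j \<in> I" for i j
    proof (cases "i = j")
      case True
      then show ?thesis
        using has_integral_const_real[of "1::real" a b] \<open>a \<le> b\<close> by (simp add: c_def)
    next
      case False
      then show ?thesis
        using has_integral_cos_mult(1)[OF ne[OF that False] \<open>a \<le> b\<close>] by (simp add: c_def)
    qed
    have c: "c i j \<le> 2 / real L" if "i \<in> I" "j \<in> I" "i \<noteq> j" for i j
    proof -
      have "c i j \<le> 2 / \<bar>t i - t j\<bar>"
        using has_integral_cos_mult(2)[OF ne[OF that] \<open>a \<le> b\<close>] that by (simp add: c_def)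
      also have "\<dots> \<le> 2 / real L"
        using I(4)[OF that] \<open>L > 0\<close> by (intro divide_left_mono) auto
      finally show ?thesis .
    qed
    \<comment> \<open>The diagonal entry is \<open>b - a\<close>; the fewer than \<open>L\<close>
      other entries, each at most \<open>2 / real L\<close>, add at most \<open>2\<close>.\<close>
    have row: "(\<Sum>j\<in>I. c i j) \<le> b - a + 2" if "i \<in> I" for i
    proof -
      have "(\<Sum>j\<in>I. c i j) = c i i + (\<Sum>j\<in>I - {i}. c i j)"
        using I(1) that by (simp add: sum.remove)
      also have "\<dots> \<le> (b - a) + (\<Sum>j\<in>I - {i}. 2 / real L)"
        using c that by (intro add_mono sum_mono) (auto simp: c_def)
      also have "(\<Sum>j\<in>I - {i}. 2 / real L) \<le> (\<Sum>j\<in>I. 2 / real L)"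
        using I(1) by (intro sum_mono2) auto
      also have "\<dots> = 2"
        using I(2) \<open>L > 0\<close> by simp
      finally show ?thesis by simp
    qed
    have H: "((\<lambda>x. \<Sum>i\<in>I. \<Sum>j\<in>I. cos (x * (t i - t j))) has_integral (\<Sum>i\<in>I. \<Sum>j\<in>I. c i j)) {a..b}"
      by (intro has_integral_sum I int)
    have ind: "((\<lambda>x. indicat_real ?K x * ((real L)\<^sup>2 / 2)) has_integral
        measure lebesgue ?K * ((real L)\<^sup>2 / 2)) {a..b}"
    proof (rule has_integral_mult_left)
      have "(indicat_real ?K has_integral measure lebesgue ?K) UNIV"
        using K by (simp add: lmeasurable_iff_has_integral)
      also have "indicat_real ?K = (\<lambda>x. if x \<in> {a..b} then indicat_real ?K x else 0)"
        by (auto simp: indicator_def)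
      finally show "(indicat_real ?K has_integral measure lebesgue ?K) {a..b}"
        by (simp only: has_integral_restrict_UNIV)
    qed
    have "measure lebesgue ?K * ((real L)\<^sup>2 / 2) \<le> (\<Sum>i\<in>I. \<Sum>j\<in>I. c i j)"
    proof (rule has_integral_le[OF ind H])
      fix x
      show "indicat_real ?K x * ((real L)\<^sup>2 / 2) \<le> (\<Sum>i\<in>I. \<Sum>j\<in>I. cos (x * (t i - t j)))"
      proof (cases "x \<in> ?K")
        case True
        then have "(\<Sum>i\<in>I. \<Sum>j\<in>I. 1 / 2) \<le> (\<Sum>i\<in>I. \<Sum>j\<in>I. cos (x * (t i - t j)))"
          using I(3) by (intro sum_mono) auto
        then show ?thesis
          using True I(2) by (simp add: power2_eq_square)
      qed (simp add: sum_cos_diff_nonneg)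
    qed
    also have "\<dots> \<le> (\<Sum>i\<in>I. b - a + 2)"
      by (intro sum_mono row)
    also have "\<dots> = real L * (b - a + 2)"
      using I(2) by simp
    finally have "real L * (measure lebesgue ?K * real L / 2) \<le> real L * (b - a + 2)"
      by (simp add: power2_eq_square mult_ac)
    then have "measure lebesgue ?K * real L / 2 \<le> b - a + 2"
      using \<open>L > 0\<close> by (simp only: mult_le_cancel_left_pos of_nat_0_less_iff)
    then show ?thesis
      using \<open>L > 0\<close> by (subst pos_le_divide_eq) auto
  qed
  have "measure lebesgue ?K \<le> 0"
  proof (rule tendsto_lowerbound)
    show "(\<lambda>L. 2 * (b - a + 2) / real L) \<longlonglongrightarrow> 0"
      by (rule lim_const_over_n)
    show "\<forall>\<^sub>F L in sequentially. measure lebesgue ?K \<le> 2 * (b - a + 2) / real L"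
      using eventually_mono[OF eventually_gt_at_top[of 0] le] .
  qed simp
  then have "measure lebesgue ?K = 0"
    using measure_nonneg[of lebesgue ?K] by linarith
  then show ?thesis
    using K by (simp add: negligible_iff_measure)
qed

text \<open>A convergent phase is Cauchy, so late terms differ by less than \<open>1 / 2\<close> and
  their quotients have real part at least \<open>1 / 2\<close>. Hence countably many sets of the
  preceding kind cover all such \<open>x\<close>.\<close>

lemma negligible_convergent_phase:
  fixes t :: "nat \<Rightarrow> real"
  assumes lim: "filterlim (\<lambda>n. \<bar>t n\<bar>) at_top sequentially"
  shows "negligible {x. convergent (\<lambda>n. cis (x * t n))}"
proof (rule negligible_subset)
  let ?K = "\<lambda>m N. {x \<in> {- real m..real m}. \<forall>i\<ge>N. \<forall>j\<ge>N. cos (x * (t i - t j)) \<ge> 1 / 2}"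
  have "negligible (?K m N)" for m N
    by (rule negligible_almost_constant_phase[OF lim]) simp
  then show "negligible (\<Union>m. \<Union>N. ?K m N)"
    by (intro negligible_countable_Union) auto
  show "{x. convergent (\<lambda>n. cis (x * t n))} \<subseteq> (\<Union>m. \<Union>N. ?K m N)"
  proof
    fix x
    assume "x \<in> {x. convergent (\<lambda>n. cis (x * t n))}"
    then have "Cauchy (\<lambda>n. cis (x * t n))"
      by (simp add: convergent_Cauchy)
    then obtain N where N: "\<And>i j. i \<ge> N \<Longrightarrow> j \<ge> N \<Longrightarrow> cmod (cis (x * t i) - cis (x * t j)) < 1 / 2"
      by (metis CauchyD half_gt_zero zero_less_one)
    have "cos (x * (t i - t j)) \<ge> 1 / 2" if "i \<ge> N" "j \<ge> N" for i j
    proof -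
      have "cis (x * t i) - cis (x * t j) = (cis (x * (t i - t j)) - 1) * cis (x * t j)"
        by (simp add: cis_mult algebra_simps)
      then have "cmod (cis (x * (t i - t j)) - 1) < 1 / 2"
        using N[OF that] by (simp add: norm_mult)
      then show ?thesis
        using abs_Re_le_cmod[of "cis (x * (t i - t j)) - 1"] by simp
    qed
    moreover obtain m :: nat where "\<bar>x\<bar> \<le> real m"
      using real_arch_simple by blast
    ultimately have "x \<in> ?K m N"
      by auto
    then show "x \<in> (\<Union>m. \<Union>N. ?K m N)"
      by blast
  qed
qed

section \<open>Fourier analysis of moving averages\<close>

lemma has_vector_derivative_shift_at:
  assumes "(f has_vector_derivative f') (at (c + x))"
  shows "((\<lambda>x. f (c + x)) has_vector_derivative f') (at (x::real))"
proof -
  have "((\<lambda>x. c + x) has_vector_derivative 1) (at x)"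
    by (auto intro!: derivative_eq_intros simp: has_vector_derivative_def)
  from vector_diff_chain_at[OF this assms] show ?thesis
    by (simp add: o_def)
qed

lemma has_vector_derivative_cis_mult:
  "((\<lambda>x. cis (c * x)) has_vector_derivative \<i> * of_real c * cis (c * x)) (at x)"
proof -
  have "((\<lambda>x. exp (\<i> * of_real c * of_real x)) has_vector_derivative exp (\<i> * of_real c * of_real x) * (\<i> * of_real c)) (at x)"
    by (rule has_vector_derivative_real_field) (auto intro!: derivative_eq_intros)
  then show ?thesis
    by (simp add: cis_conv_exp mult_ac)
qed

text \<open>If \<open>G\<close> denotes the integral of \<open>F\<close> over \<open>{x..x + s}\<close>, then subtracting \<open>1\<close> from the character
  removes the terms with \<open>G'\<close>, so that \<open>fourier_defect_shift_deriv\<close> involves \<open>G\<close> only.\<close>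

definition fourier_defect :: "real \<Rightarrow> real \<Rightarrow> (real \<Rightarrow> real) \<Rightarrow> complex" where
  "fourier_defect l s F = integral {0..s} (\<lambda>t. of_real (F t) * (cis (- l * t) - 1))"

lemma fourier_defect_shift_deriv:
  assumes F: "continuous_on UNIV F" and "s \<ge> 0" and per: "cis (l * s) = 1"
  shows "((\<lambda>x. cis (- l * x) * fourier_defect l s (\<lambda>t. F (x + t))) has_vector_derivative
    \<i> * of_real l * cis (- l * x) * of_real (integral {0..s} (\<lambda>t. F (x + t)))) (at x)"
proof -
  \<comment> \<open>Since \<open>F\<close> is only continuous, nothing is differentiated under the
    integral; the defect is expressed by primitives \<open>A\<close> of \<open>F\<close> and
    \<open>B\<close> of \<open>?f\<close>.\<close>
  have "\<exists>A. \<forall>x::real. -\<infinity> < ereal x \<longrightarrow> ereal x < \<infinity> \<longrightarrow> (A has_vector_derivative F x) (at x)"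
    by (rule einterval_antiderivative) (use F in \<open>auto simp: continuous_on_eq_continuous_at\<close>)
  then obtain A where A: "\<And>x. (A has_vector_derivative F x) (at x)"
    by auto
  let ?f = "\<lambda>x. of_real (F x) * cis (- l * x)"
  have "continuous_on UNIV ?f"
    by (intro continuous_intros F)
  then have "\<exists>B. \<forall>x::real. -\<infinity> < ereal x \<longrightarrow> ereal x < \<infinity> \<longrightarrow> (B has_vector_derivative ?f x) (at x)"
    by (intro einterval_antiderivative) (auto simp: continuous_on_eq_continuous_at)
  then obtain B where B: "\<And>x. (B has_vector_derivative ?f x) (at x)"
    by auto
  have A': "((\<lambda>t. complex_of_real (A (y + t))) has_vector_derivative of_real (F (y + t))) (at t)" for y t
    using has_vector_derivative_shift_at[OF A]
    by (intro has_vector_derivative_of_real) (simp add: has_real_derivative_iff_has_vector_derivative)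
  have B': "((\<lambda>t. B (y + t)) has_vector_derivative ?f (y + t)) (at t)" for y t
    by (intro has_vector_derivative_shift_at B)
  have intA: "integral {0..s} (\<lambda>t. F (y + t)) = A (y + s) - A y" for y
  proof (rule integral_unique)
    have "((\<lambda>t. F (y + t)) has_integral (A (y + s) - A (y + 0))) {0..s}"
      by (rule fundamental_theorem_of_calculus[OF \<open>s \<ge> 0\<close>
            has_vector_derivative_at_within[OF has_vector_derivative_shift_at[OF A]]])
    then show "((\<lambda>t. F (y + t)) has_integral (A (y + s) - A y)) {0..s}" by simp
  qed
  have cis1: "cis (l * y) * cis (- l * y) = 1" "cis (- l * y) * cis (l * y) = 1" for y
    by (simp_all add: cis_mult)
  \<comment> \<open>Passing from \<open>t\<close> to \<open>y + t\<close> in the character costs a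
    factor \<open>cis (l * y)\<close>.\<close>
  have D: "fourier_defect l s (\<lambda>t. F (y + t)) =
      cis (l * y) * (B (y + s) - B y) - of_real (A (y + s) - A y)" for y
    unfolding fourier_defect_def
  proof (rule integral_unique)
    have eq: "cis (l * y) * ?f (y + t) = of_real (F (y + t)) * cis (- l * t)" for t
      by (simp add: cis_mult algebra_simps)
    have "((\<lambda>t. cis (l * y) * B (y + t) - of_real (A (y + t))) has_vector_derivative
        of_real (F (y + t)) * (cis (- l * t) - 1)) (at t)" for t
      using has_vector_derivative_diff[OF has_vector_derivative_mult_right[OF B'[of y t], of "cis (l * y)"] A'[of y t]]
      unfolding eq by (simp add: algebra_simps)
    then have "((\<lambda>t. of_real (F (y + t)) * (cis (- l * t) - 1)) has_integral
        (cis (l * y) * B (y + s) - of_real (A (y + s))) - (cis (l * y) * B (y + 0) - of_real (A (y + 0)))) {0..s}"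
      by (intro fundamental_theorem_of_calculus[OF \<open>s \<ge> 0\<close>]) (rule has_vector_derivative_at_within)
    then show "((\<lambda>t. of_real (F (y + t)) * (cis (- l * t) - 1)) has_integral
        cis (l * y) * (B (y + s) - B y) - of_real (A (y + s) - A y)) {0..s}"
      by (simp add: algebra_simps)
  qed
  have J: "cis (- l * y) * fourier_defect l s (\<lambda>t. F (y + t)) =
      (B (s + y) - B y) - cis (- l * y) * (of_real (A (s + y)) - of_real (A y))" for y
  proof -
    have "cis (- l * y) * fourier_defect l s (\<lambda>t. F (y + t)) =
      (cis (- l * y) * cis (l * y)) * (B (y + s) - B y) - cis (- l * y) * of_real (A (y + s) - A y)"
      by (simp add: D right_diff_distrib mult.assoc)
    then show ?thesis by (simp only: cis1) (simp add: add.commute)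
  qed
  \<comment> \<open>The character has the same phase at both ends of \<open>{x..x + s}\<close>.
    Hence the terms with values of \<open>F\<close> cancel in the derivative, and only the one with
    the increment of \<open>A\<close> survives.\<close>
  have per': "?f (s + x) = of_real (F (s + x)) * cis (- l * x)"
  proof -
    have "cis (- l * s) = 1"
      using per by (metis cis_cnj complex_cnj_one mult_minus_left)
    then have "cis (- l * (s + x)) = cis (- l * x)"
      by (metis cis_mult distrib_left mult_1)
    then show ?thesis by simp
  qed
  have "((\<lambda>y. (B (s + y) - B y) - cis (- l * y) * (of_real (A (s + y)) - of_real (A y))) has_vector_derivative
     (?f (s + x) - ?f x) - (cis (- l * x) * (of_real (F (s + x)) - of_real (F x))
       + \<i> * of_real (- l) * cis (- l * x) * (of_real (A (s + x)) - of_real (A x)))) (at x)"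
    using A'[of 0]
    by (intro has_vector_derivative_diff has_vector_derivative_mult A' B' B has_vector_derivative_cis_mult)
      simp
  also have "(?f (s + x) - ?f x) - (cis (- l * x) * (of_real (F (s + x)) - of_real (F x))
       + \<i> * of_real (- l) * cis (- l * x) * (of_real (A (s + x)) - of_real (A x)))
     = \<i> * of_real l * cis (- l * x) * of_real (integral {0..s} (\<lambda>t. F (x + t)))"
    unfolding per' intA by (simp add: algebra_simps)
  finally show ?thesis unfolding J .
qed

section \<open>Continuous flows on compact spaces\<close>

text \<open>If each point had a neighbourhood visited finitely often, a finite subcover would
  account for only finitely many indices. A countable neighbourhood base at a point visited
  infinitely often then yields the subsequence.\<close>

lemma compact_first_countable_subseq:
  fixes u :: "nat \<Rightarrow> 'a"
  assumes X: "compact_space X" "first_countable X" and u: "\<And>n. u n \<in> topspace X"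
  obtains q r where "strict_mono r" and "limitin X (u \<circ> r) q sequentially"
proof -
  have "\<exists>q\<in>topspace X. \<forall>U. openin X U \<and> q \<in> U \<longrightarrow> infinite {n. u n \<in> U}"
  proof (rule ccontr)
    assume "\<not> ?thesis"
    then have "\<forall>q\<in>topspace X. \<exists>U. openin X U \<and> q \<in> U \<and> finite {n. u n \<in> U}"
      by blast
    then obtain U where U: "\<And>q. q \<in> topspace X \<Longrightarrow> openin X (U q) \<and> q \<in> U q \<and> finite {n. u n \<in> U q}"
      by metis
    then have "\<exists>\<F>. finite \<F> \<and> \<F> \<subseteq> U ` topspace X \<and> topspace X \<subseteq> \<Union>\<F>"
      using X(1)[unfolded compact_space_alt, rule_format, of "U ` topspace X"] by blast
    then obtain \<F> where \<F>: "finite \<F>" "\<F> \<subseteq> U ` topspace X" "topspace X \<subseteq> \<Union>\<F>"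
      by blast
    have "UNIV = (\<Union>V\<in>\<F>. {n. u n \<in> V})"
    proof (intro equalityI subsetI)
      show "n \<in> (\<Union>V\<in>\<F>. {n. u n \<in> V})" for n
        using subsetD[OF \<F>(3) u[of n]] by auto
    qed simp
    moreover have "finite (\<Union>V\<in>\<F>. {n. u n \<in> V})"
      using \<F> U by (intro finite_UN_I) auto
    ultimately show False
      by (metis infinite_UNIV_nat)
  qed
  then obtain q where q: "q \<in> topspace X" and inf: "\<And>U. openin X U \<Longrightarrow> q \<in> U \<Longrightarrow> infinite {n. u n \<in> U}"
    by blast
  obtain \<B> where \<B>: "countable \<B>" "\<And>V. V \<in> \<B> \<Longrightarrow> openin X V"
    "\<And>U. openin X U \<Longrightarrow> q \<in> U \<Longrightarrow> \<exists>V\<in>\<B>. q \<in> V \<and> V \<subseteq> U"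
    using X(2) q unfolding first_countable_def by meson
  define \<C> where "\<C> = {V \<in> \<B>. q \<in> V}"
  have "\<C> \<noteq> {}"
    using \<B>(3)[of "topspace X"] q by (auto simp: \<C>_def)
  then have ran: "range (from_nat_into \<C>) = \<C>"
    using \<B>(1) by (intro range_from_nat_into) (auto simp: \<C>_def)
  \<comment> \<open>Finite intersections give decreasing neighbourhoods, so from index
    \<open>N\<close> on, the subsequence stays in the \<open>N\<close>-th base set.\<close>
  define W where "W n = (\<Inter>i\<le>n. from_nat_into \<C> i)" for n :: nat
  have in\<C>: "openin X (from_nat_into \<C> i) \<and> q \<in> from_nat_into \<C> i" for i
    using ran \<B>(2) by (auto simp: \<C>_def)
  have W: "openin X (W n)" "q \<in> W n" for n
    using in\<C> by (auto simp: W_def intro: openin_Inter)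
  have "\<exists>k>m. u k \<in> W n" for m n
    using inf[OF W[of n]] by (auto simp: infinite_nat_iff_unbounded)
  then obtain nxt where nxt: "\<And>m n. nxt m n > m \<and> u (nxt m n) \<in> W n"
    by metis
  define r where "r = rec_nat (nxt 0 0) (\<lambda>n m. nxt m (Suc n))"
  have r: "strict_mono r"
    by (rule strict_monoI_Suc) (simp add: r_def nxt)
  have rW: "u (r n) \<in> W n" for n
    by (cases n) (simp_all add: r_def nxt)
  have "limitin X (u \<circ> r) q sequentially"
    unfolding limitin_sequentially
  proof (intro conjI allI impI q)
    fix U
    assume "openin X U \<and> q \<in> U"
    then obtain V where "V \<in> \<C>" "V \<subseteq> U"
      using \<B>(3) by (auto simp: \<C>_def)
    then obtain N where N: "from_nat_into \<C> N \<subseteq> U"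
      using ran by (metis imageE)
    have "(u \<circ> r) n \<in> U" if "N \<le> n" for n
      using rW[of n] N that by (auto simp: W_def)
    then show "\<exists>N. \<forall>n\<ge>N. (u \<circ> r) n \<in> U" by blast
  qed
  with r show thesis by (rule that)
qed

text \<open>The dynamical arguments rest on continuity; smoothness enters through the choice of the
  bump function.\<close>

locale topological_flow =
  fixes X :: "'a topology" and \<sigma> :: "real \<Rightarrow> 'a \<Rightarrow> 'a"
  assumes flow_in: "p \<in> topspace X \<Longrightarrow> \<sigma> t p \<in> topspace X"
    and flow_zero: "p \<in> topspace X \<Longrightarrow> \<sigma> 0 p = p"
    and flow_add: "p \<in> topspace X \<Longrightarrow> \<sigma> (s + t) p = \<sigma> s (\<sigma> t p)"
    and flow_continuous: "continuous_map (prod_topology euclideanreal X) X (\<lambda>(t, p). \<sigma> t p)"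
begin

lemma continuous_map_orbit:
  assumes "p \<in> topspace X" shows "continuous_map euclideanreal X (\<lambda>t. \<sigma> t p)"
proof -
  have "continuous_map euclideanreal (prod_topology euclideanreal X) (\<lambda>t. (t, p))"
    using assms by (intro continuous_map_pairedI) (auto simp: continuous_map_const)
  from continuous_map_compose[OF this flow_continuous] show ?thesis
    by (simp add: o_def)
qed

lemma continuous_map_time: "continuous_map X X (\<sigma> t)"
proof -
  have "continuous_map X (prod_topology euclideanreal X) (\<lambda>p. (t, p))"
    by (intro continuous_map_pairedI) (auto simp: continuous_map_const)
  from continuous_map_compose[OF this flow_continuous] show ?thesis
    by (simp add: o_def)
qed

lemma continuous_on_orbit:
  assumes "p \<in> topspace X" and "continuous_map X euclidean f"
  shows "continuous_on UNIV (\<lambda>t. f (\<sigma> t p))"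
  using continuous_map_compose[OF continuous_map_orbit[OF assms(1)] assms(2)]
  by (simp add: o_def)

text \<open>Two times with the same point differ by a period.\<close>

lemma inj_nonperiodic_orbit:
  assumes p: "p \<in> topspace X" and "nonperiodic_orbit \<sigma> p"
  shows "inj (\<lambda>t. \<sigma> t p)"
proof (rule ccontr)
  assume "\<not> ?thesis"
  then have "\<exists>a b. a < b \<and> \<sigma> a p = \<sigma> b p"
    unfolding inj_def by (metis linorder_neqE)
  then obtain a b where ab: "a < b" "\<sigma> a p = \<sigma> b p"
    by blast
  have "\<sigma> (t + (b - a)) p = \<sigma> t p" for t
    using flow_add[OF p, of "t - a" a] flow_add[OF p, of "t - a" b] ab(2)
    by (simp add: algebra_simps)
  then show False
    using assms(2) ab(1) unfolding nonperiodic_orbit_def by (metis diff_gt_0_iff_gt)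
qed

text \<open>By Baire category the orbit carries the topology of the real line.\<close>

lemma locally_closed_orbit_nbhd:
  assumes X: "compact_space X" "Hausdorff_space X" and p: "p \<in> topspace X"
    and np: "nonperiodic_orbit \<sigma> p" and lc: "locally_closed_in X (flow_orbit \<sigma> p)" and "\<epsilon> > 0"
  obtains W where "openin X W" and "p \<in> W" and "\<And>t. \<sigma> t p \<in> W \<Longrightarrow> \<bar>t\<bar> < \<epsilon>"
proof -
  let ?S = "flow_orbit \<sigma> p"
  let ?Y = "subtopology X ?S"
  define \<delta> where "\<delta> = \<epsilon> / 2"
  have \<delta>: "0 < \<delta>" "\<delta> < \<epsilon>"
    using \<open>\<epsilon> > 0\<close> by (auto simp: \<delta>_def)
  \<comment> \<open>Countably many compact arcs, each of duration
    \<open>\<delta> < \<epsilon>\<close>, cover the orbit.\<close>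
  define C where "C k = (\<lambda>t. \<sigma> t p) ` {of_int k * \<delta>..(of_int k + 1) * \<delta>}" for k :: int
  have S: "?S \<subseteq> topspace X"
    using flow_in[OF p] by (auto simp: flow_orbit_def)
  then have Y: "topspace ?Y = ?S"
    by auto
  \<comment> \<open>Local closedness makes the orbit a locally compact Hausdorff space, to which
    Baire's theorem applies.\<close>
  have lcY: "locally_compact_space ?Y"
    using lc locally_compact_subspace_open_in_closure_of_eq[OF X(2) compact_imp_locally_compact_space[OF X(1)]]
    by (simp add: locally_closed_in_def)
  have HY: "Hausdorff_space ?Y"
    using X(2) by (rule Hausdorff_space_subtopology)
  have CS: "C k \<subseteq> ?S" for k
    by (auto simp: C_def flow_orbit_def)
  have closed: "closedin ?Y (C k)" for k
  proof (rule compactin_imp_closedin[OF HY])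
    have "compactin X (C k)"
      unfolding C_def by (rule image_compactin[OF _ continuous_map_orbit[OF p]]) simp
    then show "compactin ?Y (C k)"
      using CS by (simp add: compactin_subtopology)
  qed
  have un: "\<Union>(range C) = ?S"
  proof
    show "?S \<subseteq> \<Union>(range C)"
    proof
      fix q
      assume "q \<in> ?S"
      then obtain t where t: "q = \<sigma> t p"
        by (auto simp: flow_orbit_def)
      have "of_int \<lfloor>t / \<delta>\<rfloor> * \<delta> \<le> t" "t \<le> (of_int \<lfloor>t / \<delta>\<rfloor> + 1) * \<delta>"
        using \<delta>(1) floor_divide_lower[of \<delta> t] floor_divide_upper[of \<delta> t] by auto
      then have "q \<in> C \<lfloor>t / \<delta>\<rfloor>"
        by (auto simp: C_def t)
      then show "q \<in> \<Union>(range C)" by blast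
    qed
  qed (use CS in blast)
  \<comment> \<open>Otherwise the union of the arcs, which is the whole orbit, would have empty
    interior.\<close>
  have "\<exists>k. ?Y interior_of C k \<noteq> {}"
  proof (rule ccontr)
    assume "\<not> ?thesis"
    then have "?Y interior_of \<Union>(range C) = {}"
      using lcY HY closed locally_compact_Hausdorff_imp_regular_space[OF lcY HY]
      by (intro Baire_category_alt) auto
    moreover have "?Y interior_of ?S = ?S"
      using Y by (metis interior_of_topspace)
    ultimately show False
      unfolding un by (auto simp: flow_orbit_def)
  qed
  then obtain k q where q: "q \<in> ?Y interior_of C k"
    by blast
  then have "q \<in> C k"
    using interior_of_subset[of ?Y "C k"] by blast
  then obtain t0 where t0: "q = \<sigma> t0 p" "t0 \<in> {of_int k * \<delta>..(of_int k + 1) * \<delta>}"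
    unfolding C_def by blast
  obtain W' where W': "openin X W'" "?Y interior_of C k = W' \<inter> ?S"
    by (metis openin_interior_of openin_subtopology)
  \<comment> \<open>The interior point found need not be \<open>p\<close>; its neighbourhood is
    pulled back by the time \<open>t0\<close> that carries \<open>p\<close> to it.\<close>
  define W where "W = {q \<in> topspace X. \<sigma> t0 q \<in> W'}"
  show thesis
  proof
    show "openin X W"
      unfolding W_def by (rule openin_continuous_map_preimage[OF continuous_map_time W'(1)])
    show "p \<in> W"
      using q W'(2) t0 p by (auto simp: W_def)
    fix t
    assume "\<sigma> t p \<in> W"
    then have "\<sigma> (t0 + t) p \<in> W' \<inter> ?S"
      using flow_add[OF p, of t0 t] by (simp add: W_def flow_orbit_def) (metis rangeI)
    then have "\<sigma> (t0 + t) p \<in> C k"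
      using W'(2) interior_of_subset[of ?Y "C k"] by blast
    \<comment> \<open>By injectivity, \<open>t0\<close> and \<open>t0 + t\<close> lie in the same
      interval of length \<open>\<delta>\<close>.\<close>
    then have "t0 + t \<in> {of_int k * \<delta>..(of_int k + 1) * \<delta>}"
      using inj_image_mem_iff[OF inj_nonperiodic_orbit[OF p np]] unfolding C_def by blast
    then have "\<bar>t\<bar> \<le> \<delta>"
      using t0(2) by (auto simp: algebra_simps)
    then show "\<bar>t\<bar> < \<epsilon>"
      using \<delta> by linarith
  qed
qed

text \<open>Sequential continuity in the base point, by dominated convergence: \<open>f\<close> is
  bounded on the compact space, and the other factor by \<open>2\<close>.\<close>

lemma fourier_defect_limit:
  assumes X: "compact_space X" and f: "continuous_map X euclideanreal f"
    and u: "limitin X u q sequentially" and u_in: "\<And>n. u n \<in> topspace X"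
  shows "(\<lambda>n. fourier_defect l s (\<lambda>t. f (\<sigma> t (u n)))) \<longlonglongrightarrow> fourier_defect l s (\<lambda>t. f (\<sigma> t q))"
proof -
  have "compact (f ` topspace X)"
    using image_compactin[OF _ f, of "topspace X"] X by (simp add: compact_space_def)
  then obtain B where B: "\<And>x. x \<in> topspace X \<Longrightarrow> \<bar>f x\<bar> \<le> B"
    using compact_imp_bounded[THEN bounded_iff[THEN iffD1]] by force
  have lim: "(\<lambda>n. f (\<sigma> t (u n))) \<longlonglongrightarrow> f (\<sigma> t q)" for t
    using continuous_map_limit[OF continuous_map_compose[OF continuous_map_time f] u, of t]
    by (simp add: o_def)
  have B0: "B \<ge> 0"
    using B[OF u_in[of 0]] by linarith
  show ?thesis
    unfolding fourier_defect_def
  proof (rule dominated_convergence(2)[where h = "\<lambda>_. B * 2"])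
    fix n
    show "(\<lambda>t. of_real (f (\<sigma> t (u n))) * (cis (- l * t) - 1)) integrable_on {0..s}"
      using continuous_on_orbit[OF u_in[of n] f]
      by (intro integrable_continuous_real continuous_intros) (auto intro: continuous_on_subset)
    fix t
    have "norm (cis (- l * t) - 1) \<le> 2"
      using norm_triangle_ineq4[of "cis (- l * t)" 1] by simp
    then show "norm (of_real (f (\<sigma> t (u n))) * (cis (- l * t) - 1)) \<le> B * 2"
      using B[OF flow_in[OF u_in[of n], of t]] B0 by (auto simp: norm_mult intro!: mult_mono)
  qed (auto intro!: tendsto_intros lim)
qed

end

section \<open>Averages along an orbit\<close>

lemma has_vector_derivative_Im:
  "(f has_vector_derivative D) (at x) \<Longrightarrow> ((\<lambda>x. Im (f x)) has_real_derivative Im D) (at x)"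
  using bounded_linear.has_vector_derivative[OF bounded_linear_Im]
  by (auto simp: has_real_derivative_iff_has_vector_derivative)

context topological_flow
begin

lemma orbit_defect_deriv:
  assumes p: "p \<in> topspace X" and f: "continuous_map X euclideanreal f"
    and "s \<ge> 0" and "cis (l * s) = 1"
  shows "((\<lambda>x. cis (- l * x) * fourier_defect l s (\<lambda>t. f (\<sigma> t (\<sigma> x p)))) has_vector_derivative
    \<i> * of_real l * cis (- l * x) * of_real (integral {0..s} (\<lambda>t. f (\<sigma> t (\<sigma> x p))))) (at x)"
proof -
  have "\<sigma> (y + t) p = \<sigma> t (\<sigma> y p)" for y t
    using flow_add[OF p, of t y] by (simp add: add.commute)
  then show ?thesis
    using fourier_defect_shift_deriv[OF continuous_on_orbit[OF p f] assms(3,4), of x] by simp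
qed

text \<open>The imaginary part of \<open>\<i> * cis (- l * x)\<close> is \<open>cos (l * x)\<close>,
  so the derivative of \<open>J\<close> is \<open>l\<close> times the expression in
  \<open>nonneg\<close>; at \<open>0\<close> it is positive.\<close>

lemma orbit_defect_Im_mono:
  assumes p: "p \<in> topspace X" and f: "continuous_map X euclideanreal f"
    and "s \<ge> 0" and "cis (l * s) = 1" and "l > 0"
    and nonneg: "\<And>x. cos (l * x) * integral {0..s} (\<lambda>t. f (\<sigma> t (\<sigma> x p))) \<ge> 0"
    and pos: "integral {0..s} (\<lambda>t. f (\<sigma> t p)) > 0"
  defines "J \<equiv> (\<lambda>x. Im (cis (- l * x) * fourier_defect l s (\<lambda>t. f (\<sigma> t (\<sigma> x p)))))"
  shows "mono J" and "\<exists>d>0. \<forall>h>0. h < d \<longrightarrow> J 0 < J h"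
proof -
  have D: "(J has_real_derivative l * (cos (l * x) * integral {0..s} (\<lambda>t. f (\<sigma> t (\<sigma> x p))))) (at x)" for x
    using has_vector_derivative_Im[OF orbit_defect_deriv[OF assms(1-4), of x]]
    by (simp add: J_def mult_ac)
  show "mono J"
  proof
    show "J x \<le> J y" if "x \<le> y" for x y
      by (rule DERIV_nonneg_imp_nondecreasing[OF that])
        (use D nonneg \<open>l > 0\<close> in \<open>blast intro: mult_nonneg_nonneg less_imp_le\<close>)
  qed
  show "\<exists>d>0. \<forall>h>0. h < d \<longrightarrow> J 0 < J h"
    using DERIV_pos_inc_right[OF D[of 0]] pos \<open>l > 0\<close> by (simp add: flow_zero[OF p])
qed

text \<open>Where \<open>J\<close> has a constant value \<open>c\<close> other than
  \<open>0\<close>, the phase is the defect divided by \<open>c\<close>, and the defect converges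
  along the given sequences. The constants on the two rays have different imaginary parts, so one of
  them is nonzero, but it is not known which.\<close>

lemma convergent_phase_of_localized_average:
  assumes X: "compact_space X" and p: "p \<in> topspace X" and f: "continuous_map X euclideanreal f"
    and s: "s > 0"
    and nonneg: "\<And>x. integral {0..s} (\<lambda>t. f (\<sigma> t (\<sigma> x p))) \<ge> 0"
    and pos: "integral {0..s} (\<lambda>t. f (\<sigma> t p)) > 0"
    and supp: "\<And>x. \<bar>x\<bar> \<ge> s / 4 \<Longrightarrow> integral {0..s} (\<lambda>t. f (\<sigma> t (\<sigma> x p))) = 0"
    and u: "filterlim u at_top sequentially" "limitin X (\<lambda>n. \<sigma> (u n) p) q sequentially"
    and v: "filterlim v at_bot sequentially" "limitin X (\<lambda>n. \<sigma> (v n) p) q' sequentially"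
  shows "convergent (\<lambda>n. cis (2 * pi / s * u n)) \<or> convergent (\<lambda>n. cis (2 * pi / s * v n))"
proof -
  define l where "l = 2 * pi / s"
  have l: "l > 0" "cis (l * s) = 1"
    using s by (auto simp: l_def)
  define J where "J x = cis (- l * x) * fourier_defect l s (\<lambda>t. f (\<sigma> t (\<sigma> x p)))" for x
  note J_deriv = orbit_defect_deriv[OF p f less_imp_le[OF s] l(2), folded J_def]
  have const: "\<exists>c. \<forall>x\<in>S. J x = c" if "convex S" "\<And>x. x \<in> S \<Longrightarrow> \<bar>x\<bar> \<ge> s / 4" for S
  proof -
    have "(J has_vector_derivative 0) (at x within S)" if "x \<in> S" for x
      using has_vector_derivative_at_within[OF J_deriv[of x]] supp[OF \<open>\<And>x. x \<in> S \<Longrightarrow> \<bar>x\<bar> \<ge> s / 4\<close>[OF that]]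
      by simp
    from has_vector_derivative_zero_constant[OF \<open>convex S\<close> this] show ?thesis
      by metis
  qed
  have "\<exists>c. \<forall>x\<in>{s / 4..}. J x = c"
    by (rule const) auto
  then obtain c1 where c1: "\<And>x. x \<ge> s / 4 \<Longrightarrow> J x = c1"
    by (metis atLeast_iff)
  have "\<exists>c. \<forall>x\<in>{..- (s / 4)}. J x = c"
    by (rule const) auto
  then obtain c2 where c2: "\<And>x. x \<le> - (s / 4) \<Longrightarrow> J x = c2"
    by (metis atMost_iff)
  \<comment> \<open>For \<open>\<bar>x\<bar> < s / 4\<close> the angle \<open>l * x\<close> lies
    strictly between \<open>- pi / 2\<close> and \<open>pi / 2\<close>; elsewhere the integral
    vanishes.\<close>
  have nonneg': "cos (l * x) * integral {0..s} (\<lambda>t. f (\<sigma> t (\<sigma> x p))) \<ge> 0" for x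
  proof (cases "\<bar>x\<bar> \<ge> s / 4")
    case False
    then have "\<bar>l * x\<bar> < pi / 2"
      using s by (simp add: l_def abs_mult field_simps)
    then have "cos (l * x) > 0"
      by (intro cos_gt_zero_pi) auto
    then show ?thesis using nonneg by simp
  qed (simp add: supp)
  have mono: "mono (\<lambda>x. Im (J x))" and incr: "\<exists>d>0. \<forall>h>0. h < d \<longrightarrow> Im (J 0) < Im (J h)"
    using orbit_defect_Im_mono[OF p f less_imp_le[OF s] l(2,1) nonneg' pos]
    unfolding J_def by blast+
  have "Im c2 < Im c1"
  proof -
    obtain d where d: "d > 0" "\<And>h. h > 0 \<Longrightarrow> h < d \<Longrightarrow> Im (J 0) < Im (J h)"
      using incr by blast
    \<comment> \<open>The point \<open>h\<close> lies in the range of strict growth and not beyond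
      \<open>s / 4\<close>, so monotonicity carries the gain over to \<open>c1\<close>.\<close>
    define h where "h = min (d / 2) (s / 4)"
    have h: "0 < h" "h < d" "h \<le> s / 4"
      using d(1) s by (auto simp: h_def)
    have "Im c2 = Im (J (- (s / 4)))"
      using c2 by simp
    also have "\<dots> \<le> Im (J 0)"
      using s by (intro monoD[OF mono]) simp
    also have "\<dots> < Im (J h)"
      by (rule d(2)[OF h(1,2)])
    also have "\<dots> \<le> Im (J (s / 4))"
      by (intro monoD[OF mono] h)
    finally show ?thesis
      using c1 by simp
  qed
  then have "c1 \<noteq> 0 \<or> c2 \<noteq> 0"
    by auto
  moreover have conv: "convergent (\<lambda>n. cis (l * w n))"
    if "c \<noteq> 0" "\<forall>\<^sub>F n in sequentially. J (w n) = c" "limitin X (\<lambda>n. \<sigma> (w n) p) q sequentially" for w c q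
  proof -
    have "(\<lambda>n. fourier_defect l s (\<lambda>t. f (\<sigma> t (\<sigma> (w n) p))) / c) \<longlonglongrightarrow>
        fourier_defect l s (\<lambda>t. f (\<sigma> t q)) / c"
      using that(1) by (intro tendsto_divide fourier_defect_limit[OF X f that(3)] flow_in[OF p]) auto
    moreover have "\<forall>\<^sub>F n in sequentially.
        fourier_defect l s (\<lambda>t. f (\<sigma> t (\<sigma> (w n) p))) / c = cis (l * w n)"
      using that(2)
    proof eventually_elim
      case (elim n)
      have "cis (l * w n) * c = (cis (l * w n) * cis (- l * w n)) * fourier_defect l s (\<lambda>t. f (\<sigma> t (\<sigma> (w n) p)))"
        by (simp add: J_def flip: elim)
      then show ?case
        using \<open>c \<noteq> 0\<close> by (simp add: cis_mult field_simps)
    qed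
    ultimately show ?thesis
      unfolding convergent_def by (blast intro: Lim_transform_eventually)
  qed
  moreover have "\<forall>\<^sub>F n in sequentially. J (u n) = c1"
    using u(1) by (auto simp: filterlim_at_top intro: c1 elim!: allE[of _ "s / 4"] eventually_mono)
  moreover have "\<forall>\<^sub>F n in sequentially. J (v n) = c2"
    using v(1) by (auto simp: filterlim_at_bot intro: c2 elim!: allE[of _ "- (s / 4)"] eventually_mono)
  ultimately show ?thesis
    using u(2) v(2) unfolding l_def[symmetric] by blast
qed

text \<open>Recurrence makes \<open>J (u n)\<close> converge to \<open>J 0\<close>, while
  monotonicity keeps it eventually at least \<open>J h\<close>, which exceeds
  \<open>J 0\<close>.\<close>

lemma no_average_with_recurrent_phase:
  assumes X: "compact_space X" and p: "p \<in> topspace X" and f: "continuous_map X euclideanreal f"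
    and "s \<ge> 0" and per: "cis (l * s) = 1" and "l > 0"
    and nonneg: "\<And>x. cos (l * x) * integral {0..s} (\<lambda>t. f (\<sigma> t (\<sigma> x p))) \<ge> 0"
    and pos: "integral {0..s} (\<lambda>t. f (\<sigma> t p)) > 0"
    and u: "filterlim u at_top sequentially" "limitin X (\<lambda>n. \<sigma> (u n) p) p sequentially"
    and phase: "(\<lambda>n. cis (l * u n)) \<longlonglongrightarrow> 1"
  shows False
proof -
  define J where "J x = Im (cis (- l * x) * fourier_defect l s (\<lambda>t. f (\<sigma> t (\<sigma> x p))))" for x
  note J = orbit_defect_Im_mono[OF assms(2-8), folded J_def]
  obtain h where h: "h > 0" "J 0 < J h"
    using J(2) by (meson dense)
  have "(\<lambda>n. cnj (cis (l * u n))) \<longlonglongrightarrow> cnj 1"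
    by (intro tendsto_intros phase)
  then have "(\<lambda>n. cis (- l * u n)) \<longlonglongrightarrow> 1"
    by (simp add: cis_cnj)
  then have "(\<lambda>n. J (u n)) \<longlonglongrightarrow> Im (1 * fourier_defect l s (\<lambda>t. f (\<sigma> t p)))"
    unfolding J_def by (intro tendsto_intros fourier_defect_limit[OF X f u(2)] flow_in[OF p])
  moreover have "Im (1 * fourier_defect l s (\<lambda>t. f (\<sigma> t p))) = J 0"
    by (simp add: J_def flow_zero[OF p])
  ultimately have "(\<lambda>n. J (u n)) \<longlonglongrightarrow> J 0"
    by simp
  moreover have "\<forall>\<^sub>F n in sequentially. J h \<le> J (u n)"
    using u(1) by (auto simp: filterlim_at_top intro: monoD[OF J(1)] elim!: allE[of _ h] eventually_mono)
  ultimately have "J h \<le> J 0"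
    by (intro tendsto_lowerbound) auto
  with h(2) show False by simp
qed

end

section \<open>Recurrence of linear flows on tori\<close>

text \<open>This is a form of simultaneous Diophantine approximation: by compactness, points
  \<open>V n\<close> at different integer times come close together, and the difference of the times
  is an approximate return time.\<close>

lemma torus_translation_recurrence:
  fixes \<theta> :: "real ^ 'd::finite"
  obtains u :: "nat \<Rightarrow> real" where "filterlim u at_top sequentially"
    and "\<And>i. (\<lambda>n. cis (u n * \<theta> $ i)) \<longlonglongrightarrow> 1"
proof -
  define V :: "nat \<Rightarrow> complex ^ 'd" where "V n = (\<chi> i. cis (real n * \<theta> $ i))" for n
  have "norm (V n) \<le> (\<Sum>i\<in>UNIV. norm (V n $ i))" for n
    by (simp add: norm_vec_def L2_set_le_sum)
  then have "bounded (range V)"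
    unfolding bounded_iff by (intro exI[of _ "real CARD('d)"]) (auto simp: V_def)
  then obtain L r where r: "strict_mono r" "(V \<circ> r) \<longlonglongrightarrow> L"
    using bounded_imp_convergent_subsequence by blast
  have "Cauchy (V \<circ> r)"
    using r(2) LIMSEQ_imp_Cauchy by blast
  then have "\<exists>N. \<forall>m\<ge>N. \<forall>n\<ge>N. norm ((V \<circ> r) m - (V \<circ> r) n) < 1 / real (Suc j)" for j
    by (rule CauchyD) simp
  then obtain N where N: "\<And>j m n. m \<ge> N j \<Longrightarrow> n \<ge> N j \<Longrightarrow> norm ((V \<circ> r) m - (V \<circ> r) n) < 1 / real (Suc j)"
    by metis
  have r_add: "r m + j \<le> r (m + j)" for m j
  proof (induction j)
    case (Suc j)
    then show ?case
      using strict_monoD[OF r(1), of "m + j" "m + Suc j"] by simp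
  qed simp
  \<comment> \<open>From \<open>N j\<close> on, the points are closer than
    \<open>1 / real (Suc j)\<close>; the additional \<open>j\<close> steps make \<open>u j\<close>
    at least \<open>j\<close>.\<close>
  define u where "u j = real (r (N j + j)) - real (r (N j))" for j
  show thesis
  proof
    have "real j \<le> u j" for j
      using r_add[of "N j" j] by (simp add: u_def)
    then show "filterlim u at_top sequentially"
      by (intro filterlim_at_top_mono[OF filterlim_real_sequentially]) simp
    fix i
    have bound: "norm (cis (u j * \<theta> $ i) - 1) \<le> 1 / real (Suc j)" for j
    proof -
      let ?m = "r (N j + j)" and ?n = "r (N j)"
      \<comment> \<open>The entries of \<open>V ?n\<close> have modulus one, so factoring one out
        does not change the norm.\<close>
      have "V ?m $ i - V ?n $ i = (cis (u j * \<theta> $ i) - 1) * V ?n $ i"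
        by (simp add: V_def u_def cis_mult algebra_simps)
      then have "norm (cis (u j * \<theta> $ i) - 1) = norm ((V ?m - V ?n) $ i)"
        by (simp add: norm_mult V_def)
      also have "\<dots> \<le> norm (V ?m - V ?n)"
        by (rule Finite_Cartesian_Product.norm_nth_le)
      also have "\<dots> \<le> 1 / real (Suc j)"
        using N[of j "N j + j" "N j"] by simp
      finally show ?thesis .
    qed
    have "(\<lambda>j. cis (u j * \<theta> $ i) - 1) \<longlonglongrightarrow> 0"
      by (rule Lim_null_comparison[OF always_eventually[OF allI[OF bound]]])
        (rule LIMSEQ_Suc[OF lim_1_over_n])
    then show "(\<lambda>j. cis (u j * \<theta> $ i)) \<longlonglongrightarrow> 1"
      by (simp add: LIM_zero_iff)
  qed
qed

section \<open>Smooth flows\<close>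

lemma smooth_flow_topological_flow:
  assumes "smooth_flow M \<sigma>"
  shows "topological_flow (mtop M) \<sigma>"
  using assms
  by unfold_locales
    (auto simp: smooth_flow_def smooth_map_def prod_manifold_def euclidean_manifold_def)

lemma smooth_functions_continuous:
  "f \<in> smooth_functions M \<Longrightarrow> continuous_map (mtop M) euclideanreal f"
  by (auto simp: smooth_functions_def smooth_map_def euclidean_manifold_def)

text \<open>The function \<open>f\<close> is a preimage of a bump function \<open>g\<close> under
  the averaging operator; its integrals are \<open>s * g q\<close> and inherit sign and support from
  \<open>g\<close>.\<close>

lemma average_surjective_localized:
  fixes M :: "('a, 'e::euclidean_space) manifold"
  assumes M: "smooth_manifold M" and surj: "average_surjective M \<sigma> s" and s: "s > 0"
    and W: "openin (mtop M) W" "p \<in> W"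
  obtains f where "continuous_map (mtop M) euclideanreal f"
    and "\<And>q. q \<in> points M \<Longrightarrow> integral {0..s} (\<lambda>t. f (\<sigma> t q)) \<ge> 0"
    and "integral {0..s} (\<lambda>t. f (\<sigma> t p)) > 0"
    and "\<And>q. q \<in> points M \<Longrightarrow> q \<notin> W \<Longrightarrow> integral {0..s} (\<lambda>t. f (\<sigma> t q)) = 0"
proof -
  have p: "p \<in> points M"
    using W openin_subset by blast
  obtain g where g: "g \<in> smooth_functions M" "\<And>q. q \<in> points M \<Longrightarrow> g q \<ge> 0"
    "g p > 0" "\<And>q. q \<in> points M \<Longrightarrow> q \<notin> W \<Longrightarrow> g q = 0"
    using smooth_bump_function[OF M W] by blast
  obtain f where f: "f \<in> smooth_functions M" "flow_average M \<sigma> s f = g"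
    using surj g(1) by (auto simp: average_surjective_def)
  have eq: "integral {0..s} (\<lambda>t. f (\<sigma> t q)) = s * g q" if "q \<in> points M" for q
    using fun_cong[OF f(2), of q] that s by (simp add: flow_average_def field_simps)
  show thesis
    by (rule that[OF smooth_functions_continuous[OF f(1)]]) (use eq g s p in auto)
qed

lemma not_average_surjective_nonperiodic:
  fixes M :: "('a, 'e::euclidean_space) manifold"
  assumes M: "smooth_manifold M" and X: "compact_space (mtop M)" and flow: "smooth_flow M \<sigma>"
    and p: "p \<in> points M" and np: "nonperiodic_orbit \<sigma> p"
    and lc: "locally_closed_in (mtop M) (flow_orbit \<sigma> p)"
  shows "AE s in lebesgue. s > 0 \<longrightarrow> \<not> average_surjective M \<sigma> s"
proof -
  interpret topological_flow "mtop M" \<sigma>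
    using flow by (rule smooth_flow_topological_flow)
  have top: "Hausdorff_space (mtop M)" "first_countable (mtop M)"
    using M by (auto simp: smooth_manifold_def second_countable_imp_first_countable)
  \<comment> \<open>Limit points of the orbit are chosen in both time directions before
    \<open>s\<close> is fixed, so that the exceptional set \<open>N\<close> does not depend on
    \<open>s\<close>.\<close>
  obtain q r where r: "strict_mono r" "limitin (mtop M) ((\<lambda>n. \<sigma> (real n) p) \<circ> r) q sequentially"
    using compact_first_countable_subseq[OF X top(2), of "\<lambda>n. \<sigma> (real n) p"] flow_in[OF p] by blast
  obtain q' r' where r': "strict_mono r'" "limitin (mtop M) ((\<lambda>n. \<sigma> (- real n) p) \<circ> r') q' sequentially"
    using compact_first_countable_subseq[OF X top(2), of "\<lambda>n. \<sigma> (- real n) p"] flow_in[OF p] by blast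
  define u where "u n = real (r n)" for n
  define v where "v n = - real (r' n)" for n
  have u: "filterlim u at_top sequentially" "limitin (mtop M) (\<lambda>n. \<sigma> (u n) p) q sequentially"
    using r filterlim_compose[OF filterlim_real_sequentially filterlim_subseq[OF r(1)]]
    by (simp_all add: u_def[abs_def] o_def)
  have v: "filterlim v at_bot sequentially" "limitin (mtop M) (\<lambda>n. \<sigma> (v n) p) q' sequentially"
    using r' filterlim_compose[OF filterlim_real_sequentially filterlim_subseq[OF r'(1)]]
    by (simp_all add: v_def[abs_def] o_def filterlim_uminus_at_top)
  have v_abs: "filterlim (\<lambda>n. \<bar>v n\<bar>) at_top sequentially"
    using filterlim_compose[OF filterlim_real_sequentially filterlim_subseq[OF r'(1)]]
    by (simp add: v_def)
  define N where "N = {l. convergent (\<lambda>n. cis (l * u n))} \<union> {l. convergent (\<lambda>n. cis (l * v n))}"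
  have "negligible N"
    unfolding N_def
    by (intro negligible_Un negligible_convergent_phase
        filterlim_compose[OF filterlim_abs_real u(1)] v_abs)
  \<comment> \<open>The map from \<open>l\<close> to \<open>s = 2 * pi / l\<close> is differentiable
    away from \<open>0\<close> and therefore preserves null sets there.\<close>
  then have "negligible ((\<lambda>l. 2 * pi / l) ` (N - {0}))"
    by (intro negligible_differentiable_image_negligible)
      (auto intro: negligible_subset simp: differentiable_on_def intro!: derivative_intros)
  then have "(\<lambda>l. 2 * pi / l) ` (N - {0}) \<in> null_sets lebesgue"
    by (simp add: negligible_iff_null_sets)
  then show ?thesis
  proof (rule AE_I')
    show "{s \<in> space lebesgue. \<not> (s > 0 \<longrightarrow> \<not> average_surjective M \<sigma> s)} \<subseteq> (\<lambda>l. 2 * pi / l) ` (N - {0})"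
    proof
      fix s
      assume "s \<in> {s \<in> space lebesgue. \<not> (s > 0 \<longrightarrow> \<not> average_surjective M \<sigma> s)}"
      then have s: "s > 0" and surj: "average_surjective M \<sigma> s"
        by auto
      \<comment> \<open>The character \<open>cis (l * x)\<close> with \<open>l = 2 * pi / s\<close>
        has period \<open>s\<close>; its real part is positive within a quarter period of
        \<open>0\<close>.\<close>
      have "s / 4 > 0"
        using s by simp
      then obtain W where W: "openin (mtop M) W" "p \<in> W" "\<And>t. \<sigma> t p \<in> W \<Longrightarrow> \<bar>t\<bar> < s / 4"
        using locally_closed_orbit_nbhd[OF X top(1) p np lc] by blast
      obtain f where f: "continuous_map (mtop M) euclideanreal f"
        "\<And>q. q \<in> points M \<Longrightarrow> integral {0..s} (\<lambda>t. f (\<sigma> t q)) \<ge> 0"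
        "integral {0..s} (\<lambda>t. f (\<sigma> t p)) > 0"
        "\<And>q. q \<in> points M \<Longrightarrow> q \<notin> W \<Longrightarrow> integral {0..s} (\<lambda>t. f (\<sigma> t q)) = 0"
        using average_surjective_localized[OF M surj s W(1,2)] by blast
      have "2 * pi / s \<in> N"
        unfolding N_def Un_iff mem_Collect_eq
      proof (rule convergent_phase_of_localized_average[OF X p f(1) s _ f(3) _ u v])
        show "integral {0..s} (\<lambda>t. f (\<sigma> t (\<sigma> x p))) \<ge> 0" for x
          by (intro f(2) flow_in p)
        show "integral {0..s} (\<lambda>t. f (\<sigma> t (\<sigma> x p))) = 0" if "\<bar>x\<bar> \<ge> s / 4" for x
          using W(3)[of x] that by (intro f(4) flow_in p) linarith
      qed
      then show "s \<in> (\<lambda>l. 2 * pi / l) ` (N - {0})"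
        using s by (intro image_eqI[of _ _ "2 * pi / s"]) auto
    qed
  qed
qed

text \<open>Some coordinate \<open>i\<close> of the torus moves. The recurrence argument works for
  every positive rational multiple \<open>s\<close> of the period of this coordinate, and these are
  dense.\<close>

lemma not_average_surjective_linear_torus:
  fixes M :: "('a, 'e::euclidean_space) manifold"
  assumes M: "smooth_manifold M" and X: "compact_space (mtop M)" and flow: "smooth_flow M \<sigma>"
    and p: "p \<in> points M"
    and torus: "linear_flow_torus TYPE('d::finite) M \<sigma> (mtop M closure_of flow_orbit \<sigma> p)"
  shows "{0<..} \<subseteq> closure {s. s > 0 \<and> \<not> average_surjective M \<sigma> s}"
proof -
  interpret topological_flow "mtop M" \<sigma>
    using flow by (rule smooth_flow_topological_flow)
  let ?X = "mtop M"
  define T where "T = ?X closure_of flow_orbit \<sigma> p"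
  define Z :: "(complex ^ 'd) set" where "Z = {z. \<forall>i. z $ i \<in> sphere 0 1}"
  have orbit: "flow_orbit \<sigma> p \<subseteq> points M"
    using flow_in[OF p] by (auto simp: flow_orbit_def)
  have T_sub: "T \<subseteq> points M"
    unfolding T_def by (rule closure_of_subset_topspace)
  have "flow_orbit \<sigma> p \<subseteq> T"
    unfolding T_def by (rule closure_of_subset[OF orbit])
  then have orbit_T: "\<sigma> t p \<in> T" for t
    by (auto simp: flow_orbit_def)
  have p_T: "p \<in> T"
    using orbit_T[of 0] flow_zero[OF p] by simp
  obtain h \<theta> where h: "diffeomorphism (submanifold M T :: ('a, real ^ 'd) manifold)
        (torus :: (complex ^ 'd, real ^ 'd) manifold) h"
    and lin: "\<And>t q. q \<in> T \<Longrightarrow> h (\<sigma> t q) = linear_torus_flow \<theta> t (h q)"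
    using torus unfolding linear_flow_torus_def T_def[symmetric] by blast
  have mtops: "mtop (submanifold M T :: ('a, real ^ 'd) manifold) = subtopology ?X T"
    "mtop (torus :: (complex ^ 'd, real ^ 'd) manifold) = top_of_set Z"
    by (simp_all add: submanifold_def torus_def Z_def)
  have tops: "topspace (subtopology ?X T) = T" "topspace (top_of_set Z) = Z"
    using T_sub by auto
  have bij: "bij_betw h T Z" and h_cont: "continuous_map (subtopology ?X T) (top_of_set Z) h"
    and inv_cont: "continuous_map (top_of_set Z) (subtopology ?X T) (inv_into T h)"
    using h unfolding diffeomorphism_def smooth_map_def mtops tops by blast+
  have inv_h: "inv_into T h (h q) = q" if "q \<in> T" for q
    using bij that by (simp add: bij_betw_inv_into_left)
  have hZ: "h q \<in> Z" if "q \<in> T" for q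
    using bij that bij_betwE by blast
  have orbit_h: "h (\<sigma> t p) $ i = cis (t * \<theta> $ i) * h p $ i" for t i
    using lin[OF p_T] by (simp add: linear_torus_flow_def cis_conv_exp)
  have hp: "norm (h p $ i) = 1" for i
    using hZ[OF p_T] by (simp add: Z_def)
  \<comment> \<open>Without motion the orbit and its closure would be a single point, but a torus of
    positive dimension contains the two points with all coordinates \<open>1\<close> and all
    coordinates \<open>-1\<close>.\<close>
  have "\<exists>i. \<theta> $ i \<noteq> 0"
  proof (rule ccontr)
    assume "\<not> ?thesis"
    then have "h (\<sigma> t p) = h p" for t
      by (simp add: vec_eq_iff orbit_h)
    then have "\<sigma> t p = p" for t
      using inv_h[OF orbit_T[of t]] inv_h[OF p_T] by simp
    then have "flow_orbit \<sigma> p = {p}"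
      by (auto simp: flow_orbit_def)
    moreover have "closedin ?X {p}"
      using M p by (simp add: smooth_manifold_def closedin_Hausdorff_singleton)
    ultimately have "T = {p}"
      by (simp add: T_def closure_of_closedin)
    then have "Z = {h p}"
      using bij by (auto simp: bij_betw_def)
    moreover have "(\<chi> i. 1) \<in> Z" "(\<chi> i. -1) \<in> Z"
      by (auto simp: Z_def)
    ultimately have "(\<chi> i. (1::complex)) = (\<chi> i::'d. -1)"
      by auto
    then show False
      by (simp add: vec_eq_iff)
  qed
  then obtain i where i: "\<theta> $ i \<noteq> 0"
    by blast
  obtain u where u: "filterlim u at_top sequentially" "\<And>j. (\<lambda>n. cis (u n * \<theta> $ j)) \<longlonglongrightarrow> 1"
    using torus_translation_recurrence[of \<theta>] by blast
  \<comment> \<open>All coordinates return along \<open>u\<close>, and the continuous inverse of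
    \<open>h\<close> carries this back to \<open>M\<close>.\<close>
  have recur: "limitin ?X (\<lambda>n. \<sigma> (u n) p) p sequentially"
  proof -
    have "(\<lambda>n. h (\<sigma> (u n) p)) \<longlonglongrightarrow> h p"
    proof (rule vec_tendstoI)
      show "(\<lambda>n. h (\<sigma> (u n) p) $ j) \<longlonglongrightarrow> h p $ j" for j
        using tendsto_mult[OF u(2)[of j] tendsto_const[of "h p $ j"]] by (simp add: orbit_h)
    qed
    then have "limitin (top_of_set Z) (\<lambda>n. h (\<sigma> (u n) p)) (h p) sequentially"
      using hZ[OF orbit_T] hZ[OF p_T] by (simp add: limitin_subtopology)
    from continuous_map_limit[OF inv_cont this] show ?thesis
      by (simp add: o_def inv_h orbit_T p_T limitin_subtopology)
  qed
  have not_surj: "\<not> average_surjective M \<sigma> s"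
    if s: "s > 0" and n: "s * (real n * \<bar>\<theta> $ i\<bar>) = 2 * pi * real m" "n > 0" for s m n
  proof
    assume surj: "average_surjective M \<sigma> s"
    define l where "l = real n * \<bar>\<theta> $ i\<bar>"
    have l: "l > 0"
      using n(2) i by (simp add: l_def)
    have per: "cis (l * s) = 1"
      using n(1) by (simp add: l_def mult.commute[of _ s] cis_multiple_2pi)
    \<comment> \<open>Conjugation replaces a negative frequency by its absolute value and the power
      multiplies it by \<open>n\<close>, so \<open>ph\<close> turns the phase of coordinate
      \<open>i\<close> into \<open>cis (l * t)\<close>.\<close>
    define ph where "ph w = (if \<theta> $ i > 0 then w else cnj w) ^ n" for w :: complex
    have ph_cont: "continuous_on UNIV ph"
      unfolding ph_def by (cases "\<theta> $ i > 0") (auto intro!: continuous_intros)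
    have ph_cis: "ph (cis (t * \<theta> $ i)) = cis (l * t)" for t
      using i by (auto simp: ph_def l_def Complex.DeMoivre cis_cnj mult_ac)
    have ph_1: "ph 1 = 1"
      by (simp add: ph_def)
    \<comment> \<open>Divided by \<open>h p $ i\<close>, the coordinate starts at \<open>1\<close>
      in \<open>p\<close>. The function therefore takes the value \<open>cos (l * x)\<close> at
      \<open>\<sigma> x p\<close>, and the set where it is positive is a neighbourhood of
      \<open>p\<close> in \<open>T\<close>.\<close>
    have cont: "continuous_map (subtopology ?X T) euclideanreal (\<lambda>q. Re (ph (h q $ i / h p $ i)))"
    proof -
      have "continuous_on UNIV (\<lambda>z::complex ^ 'd. Re (ph (z $ i / h p $ i)))"
        using hp[of i] by (intro continuous_intros continuous_on_compose2[OF ph_cont]) auto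
      then have "continuous_map euclidean euclideanreal (\<lambda>z::complex ^ 'd. Re (ph (z $ i / h p $ i)))"
        by simp
      from continuous_map_compose[OF continuous_map_into_fulltopology[OF h_cont] this] show ?thesis
        by (simp add: o_def)
    qed
    have "openin (subtopology ?X T) {q \<in> T. Re (ph (h q $ i / h p $ i)) \<in> {0<..}}"
      using openin_continuous_map_preimage[OF cont, of "{0<..}"] unfolding tops(1) by simp
    \<comment> \<open>The bump function needs an open set of \<open>M\<close>; off \<open>T\<close>
      its shape does not matter, as the sign condition concerns orbit points only.\<close>
    then obtain W where W: "openin ?X W" "{q \<in> T. Re (ph (h q $ i / h p $ i)) \<in> {0<..}} = W \<inter> T"
      by (auto simp: openin_subtopology)
    have hp0: "h p $ i \<noteq> 0"
      using hp[of i] by auto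
    have "p \<in> {q \<in> T. Re (ph (h q $ i / h p $ i)) \<in> {0<..}}"
      using p_T hp0 ph_1 by simp
    then have "p \<in> W"
      unfolding W(2) by blast
    have W_cos: "cos (l * x) > 0" if "\<sigma> x p \<in> W" for x
    proof -
      have "\<sigma> x p \<in> W \<inter> T"
        using that orbit_T by blast
      then have "Re (ph (h (\<sigma> x p) $ i / h p $ i)) > 0"
        unfolding W(2)[symmetric] by simp
      then show ?thesis
        using hp0 by (simp add: orbit_h ph_cis)
    qed
    obtain f where f: "continuous_map ?X euclideanreal f"
      "\<And>q. q \<in> points M \<Longrightarrow> integral {0..s} (\<lambda>t. f (\<sigma> t q)) \<ge> 0"
      "integral {0..s} (\<lambda>t. f (\<sigma> t p)) > 0"
      "\<And>q. q \<in> points M \<Longrightarrow> q \<notin> W \<Longrightarrow> integral {0..s} (\<lambda>t. f (\<sigma> t q)) = 0"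
      using average_surjective_localized[OF M surj s W(1) \<open>p \<in> W\<close>] by blast
    have "(\<lambda>n. ph (cis (u n * \<theta> $ i))) \<longlonglongrightarrow> ph 1"
      using ph_cont by (intro continuous_on_tendsto_compose[OF _ u(2)[of i]]) auto
    then have phase: "(\<lambda>n. cis (l * u n)) \<longlonglongrightarrow> 1"
      by (simp add: ph_cis ph_1)
    have "cos (l * x) * integral {0..s} (\<lambda>t. f (\<sigma> t (\<sigma> x p))) \<ge> 0" for x
    proof (cases "\<sigma> x p \<in> W")
      case True
      then show ?thesis
        using W_cos[of x] f(2)[OF flow_in[OF p, of x]] by simp
    qed (simp add: f(4) flow_in[OF p])
    from no_average_with_recurrent_phase[OF X p f(1) less_imp_le[OF s] per l this f(3) u(1) recur phase]
    show False .
  qed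
  show ?thesis
  proof
    fix s :: real
    assume "s \<in> {0<..}"
    then have s: "s > 0" by simp
    \<comment> \<open>This is the period of coordinate \<open>i\<close>; a rational slightly above
      \<open>s / ?c\<close> will give the desired parameter near \<open>s\<close>.\<close>
    let ?c = "2 * pi / \<bar>\<theta> $ i\<bar>"
    have c: "?c > 0"
      using i by simp
    show "s \<in> closure {s. s > 0 \<and> \<not> average_surjective M \<sigma> s}"
      unfolding closure_approachable
    proof (intro allI impI)
      fix e :: real
      assume "e > 0"
      then have "s / ?c < (s + e) / ?c"
        using c by (intro divide_strict_right_mono) auto
      then obtain \<rho> where \<rho>: "\<rho> \<in> \<rat>" "s / ?c < \<rho>" "\<rho> < (s + e) / ?c"
        using Rats_dense_in_real by blast
      have "\<rho> > 0"
        using \<rho>(2) s c by (meson divide_pos_pos less_trans)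
      then obtain m n :: nat where mn: "n \<noteq> 0" "\<rho> = real m / real n"
        using Rats_abs_nat_div_natE[OF \<rho>(1)] by (metis abs_of_pos)
      have "\<not> average_surjective M \<sigma> (\<rho> * ?c)"
      proof (rule not_surj)
        show "\<rho> * ?c > 0"
          using \<open>\<rho> > 0\<close> c by (rule mult_pos_pos)
        show "\<rho> * ?c * (real n * \<bar>\<theta> $ i\<bar>) = 2 * pi * real m"
          using i mn by simp
      qed (use mn in simp)
      moreover have "\<rho> * ?c > 0"
        using \<open>\<rho> > 0\<close> c by (rule mult_pos_pos)
      moreover have "s < \<rho> * ?c" "\<rho> * ?c < s + e"
        using \<rho>(2,3) c by (simp_all only: pos_divide_less_eq pos_less_divide_eq)
      ultimately show "\<exists>y\<in>{s. s > 0 \<and> \<not> average_surjective M \<sigma> s}. dist y s < e"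
        by (intro bexI[of _ "\<rho> * ?c"]) (auto simp: dist_real_def)
    qed
  qed
qed

theorem theorem3p10:
  fixes M :: "('a, 'e::euclidean_space) manifold" and \<sigma> :: "real \<Rightarrow> 'a \<Rightarrow> 'a"
  assumes "smooth_manifold M" and "compact_space (mtop M)"
    and "smooth_flow M \<sigma>" and "nontrivial_flow M \<sigma>"
  shows "((\<exists>p\<in>points M. nonperiodic_orbit \<sigma> p \<and> locally_closed_in (mtop M) (flow_orbit \<sigma> p)) \<longrightarrow>
            (AE s in lebesgue. s > 0 \<longrightarrow> \<not> average_surjective M \<sigma> s)) \<and>
         ((\<exists>p\<in>points M.
             linear_flow_torus TYPE('d::finite) M \<sigma> (mtop M closure_of flow_orbit \<sigma> p)) \<longrightarrow>
            {0<..} \<subseteq> closure {s. s > 0 \<and> \<not> average_surjective M \<sigma> s})"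
  using not_average_surjective_nonperiodic[OF assms(1-3)]
    not_average_surjective_linear_torus[OF assms(1-3)]
  by blast

end
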